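(* Let $n\ge 1$ and let $w\in S_n$ be a fireworks permutation. Let $\alpha\in\mathbb Z_{\ge 0}^n$ and $i\in[n]$. If the monomial $\mathbf x^\alpha$ appears (with nonzero coefficient) in the Grothendieck polynomial $\mathfrak G_w$ and $x_i\cdot\mathbf x^\alpha$ divides $\mathbf x^{\mathrm{wt}(\overline{D(w)})}$, then $x_i\cdot\mathbf x^\alpha$ appears in $\mathfrak G_w$. In particular, $$\mathrm{supp}(\mathfrak G_w)=\bigcup_{\alpha\in\mathrm{supp}(\mathfrak S_w)}[\alpha,\mathrm{wt}(\overline{D(w)})].$$
   Context: Notation: $[n]=\{1,\dots,n\}$; permutations $w\in S_n$ are written in one-line notation $w(1)\,w(2)\cdots w(n)$; $\ell(w)$ is the number of inversions; $w_0$ is the longest element of $S_n$; $s_i$ is the adjacent transposition $(i\ i+1)$; $\mathbf x^\alpha=x_1^{\alpha_1}\cdots x_n^{\alpha_n}$. Fireworks: $w\in S_n$ is fireworks if the initial terms of its decreasing runs (maximal decreasing strings of consecutive entries $w(a)>w(a+1)>\dots>w(b)$) are increasing from left to right. Equivalently, there are no $i<j$ with $w(j)<w(j+1)<w(i)$. Schubert and Grothendieck polynomials: for $i\in[n-1]$ and $f\in\mathbb Z[x_1,\dots,x_n]$ let $\partial_i(f)=\frac{f-s_if}{x_i-x_{i+1}}$, where $s_i$ acts by switching $x_i$ and $x_{i+1}$, and let $\overline\partial_i(f)=\partial_i((1-x_{i+1})f)$. Then $\mathfrak S_{w_0}=\mathfrak G_{w_0}=x_1^{n-1}x_2^{n-2}\cdots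 x_{n-1}$, and whenever $\ell(w)<\ell(ws_i)$, $\mathfrak S_w=\partial_i(\mathfrak S_{ws_i})$ and $\mathfrak G_w=\overline\partial_i(\mathfrak G_{ws_i})$. Rothe diagram: $D(w)=\{(i,j)\in[n]\times[n]: i<w^{-1}(j)\text{ and }j<w(i)\}$ ($i$ is the row, $j$ the column). For a diagram $D\subseteq[n]\times[m]$ the upwards closure is $\overline D=\{(i,j)\in[n]\times[m]: (i',j)\in D\text{ for some }i'\ge i\}$, and $\mathrm{wt}(D)\in\mathbb Z_{\ge0}^n$ is the vector whose $i$-th component is the number of boxes of $D$ in row $i$. Support: for a polynomial $f\in\mathbb Z[x_1,\dots,x_n]$, $\mathrm{supp}(f)\subset\mathbb Z_{\ge0}^n$ is the set of exponent vectors of monomials with nonzero coefficient in $f$. For $\alpha,\beta\in\mathbb Z^n$, $[\alpha,\beta]=\{\gamma\in\mathbb Z^n:\alpha_i\le\gamma_i\le\beta_i\text{ for all }i\}$. *)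

theory Defs
  imports "HOL-Library.Poly_Mapping" "HOL-Combinatorics.Permutations"
begin

section \<open>Permutations\<close>

text \<open>An element of $S_n$ is a function \<open>w :: nat \<Rightarrow> nat\<close> with \<open>w permutes {1..n}\<close>.\<close>

definition perm_length :: "nat \<Rightarrow> (nat \<Rightarrow> nat) \<Rightarrow> nat" where
  "perm_length n w = card {(i, j). i \<in> {1..n} \<and> j \<in> {1..n} \<and> i < j \<and> w j < w i}"

definition longest_perm :: "nat \<Rightarrow> nat \<Rightarrow> nat" where
  "longest_perm n i = (if i \<in> {1..n} then n + 1 - i else i)"

abbreviation adj :: "nat \<Rightarrow> nat \<Rightarrow> nat" where
  "adj i \<equiv> Transposition.transpose i (Suc i)"

definition decreasing_run :: "nat \<Rightarrow> (nat \<Rightarrow> nat) \<Rightarrow> nat \<Rightarrow> nat \<Rightarrow> bool" where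
  "decreasing_run n w a b \<longleftrightarrow>
     1 \<le> a \<and> a \<le> b \<and> b \<le> n \<and> (\<forall>k. a \<le> k \<and> k < b \<longrightarrow> w (k + 1) < w k) \<and>
     (a = 1 \<or> \<not> w a < w (a - 1)) \<and> (b = n \<or> \<not> w (b + 1) < w b)"

definition fireworks :: "nat \<Rightarrow> (nat \<Rightarrow> nat) \<Rightarrow> bool" where
  "fireworks n w \<longleftrightarrow>
     (\<forall>a b c d. decreasing_run n w a b \<and> decreasing_run n w c d \<and> a < c \<longrightarrow> w a < w c)"

section \<open>Diagrams\<close>

text \<open>Boxes are pairs (row, column).\<close>

definition rothe :: "nat \<Rightarrow> (nat \<Rightarrow> nat) \<Rightarrow> (nat \<times> nat) set" where
  "rothe n w = {(i, j). i \<in> {1..n} \<and> j \<in> {1..n} \<and> i < inv w j \<and> j < w i}"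

definition up_closure :: "nat \<Rightarrow> nat \<Rightarrow> (nat \<times> nat) set \<Rightarrow> (nat \<times> nat) set" where
  "up_closure n m D = {(i, j). i \<in> {1..n} \<and> j \<in> {1..m} \<and> (\<exists>i'\<ge>i. (i', j) \<in> D)}"

definition wt :: "nat \<Rightarrow> (nat \<times> nat) set \<Rightarrow> (nat \<Rightarrow>\<^sub>0 nat)" where
  "wt n D = (\<Sum>i = 1..n. Poly_Mapping.single i (card {j. (i, j) \<in> D}))"

section \<open>Polynomials\<close>

text \<open>
  Polynomials over the integers in variables indexed by natural numbers; those in
  $\mathbb{Z}[x_1,\dots,x_n]$ are the ones all of whose exponent vectors have their support in
  \<open>{1..n}\<close>.  The support of a polynomial \<open>f\<close> is \<open>Poly_Mapping.keys f\<close>.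
\<close>

type_synonym mpoly = "(nat \<Rightarrow>\<^sub>0 nat) \<Rightarrow>\<^sub>0 int"

abbreviation supp :: "mpoly \<Rightarrow> (nat \<Rightarrow>\<^sub>0 nat) set" where
  "supp \<equiv> Poly_Mapping.keys"

definition xpow :: "(nat \<Rightarrow>\<^sub>0 nat) \<Rightarrow> mpoly" where
  "xpow \<alpha> = Poly_Mapping.single \<alpha> 1"

definition X :: "nat \<Rightarrow> mpoly" where
  "X i = xpow (Poly_Mapping.single i 1)"

definition exps :: "nat \<Rightarrow> (nat \<Rightarrow>\<^sub>0 nat) set" where
  "exps n = {\<alpha>. Poly_Mapping.keys \<alpha> \<subseteq> {1..n}}"

definition box :: "nat \<Rightarrow> (nat \<Rightarrow>\<^sub>0 nat) \<Rightarrow> (nat \<Rightarrow>\<^sub>0 nat) \<Rightarrow> (nat \<Rightarrow>\<^sub>0 nat) set" where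
  "box n \<alpha> \<beta> = {\<gamma> \<in> exps n. \<forall>i \<in> {1..n}.
     Poly_Mapping.lookup \<alpha> i \<le> Poly_Mapping.lookup \<gamma> i \<and> Poly_Mapping.lookup \<gamma> i \<le> Poly_Mapping.lookup \<beta> i}"

text \<open>
  The coefficient of \<open>\<alpha>\<close> in \<open>swap_vars i f\<close> is the coefficient in \<open>f\<close> of \<open>\<alpha>\<close> with its
  entries \<open>i\<close> and \<open>i + 1\<close> exchanged.
\<close>

definition swap_vars :: "nat \<Rightarrow> mpoly \<Rightarrow> mpoly" where
  "swap_vars i f = Poly_Mapping.map_key (Poly_Mapping.map_key (adj i)) f"

text \<open>The quotient exists and is unique, see \<open>div_diff_eq\<close> and \<open>div_diff_unique\<close> below.\<close>

definition div_diff :: "nat \<Rightarrow> mpoly \<Rightarrow> mpoly" where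
  "div_diff i f = (THE g. (X i - X (i + 1)) * g = f - swap_vars i f)"

definition K_div_diff :: "nat \<Rightarrow> mpoly \<Rightarrow> mpoly" where
  "K_div_diff i f = div_diff i ((1 - X (i + 1)) * f)"

text \<open>
  \<open>op_chain op n w f\<close>: \<open>f\<close> is obtained from $x_1^{n-1} x_2^{n-2} \cdots x_{n-1}$ at
  the longest permutation by applying the operators \<open>op i\<close> along some chain of length-decreasing
  adjacent transpositions down to \<open>w\<close>.  That \<open>f\<close> depends only on \<open>w\<close> is proved below.
\<close>

inductive op_chain :: "(nat \<Rightarrow> mpoly \<Rightarrow> mpoly) \<Rightarrow> nat \<Rightarrow> (nat \<Rightarrow> nat) \<Rightarrow> mpoly \<Rightarrow> bool"
  for op :: "nat \<Rightarrow> mpoly \<Rightarrow> mpoly" and n :: nat where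
  longest: "op_chain op n (longest_perm n) (\<Prod>i = 1..n. X i ^ (n - i))"
| step: "\<lbrakk>w permutes {1..n}; 1 \<le> i; i < n; perm_length n w < perm_length n (w \<circ> adj i);
          op_chain op n (w \<circ> adj i) f\<rbrakk> \<Longrightarrow> op_chain op n w (op i f)"

definition schubert :: "nat \<Rightarrow> (nat \<Rightarrow> nat) \<Rightarrow> mpoly" where
  "schubert n w = (THE f. op_chain div_diff n w f)"

definition grothendieck :: "nat \<Rightarrow> (nat \<Rightarrow> nat) \<Rightarrow> mpoly" where
  "grothendieck n w = (THE f. op_chain K_div_diff n w f)"

section \<open>The divided differences are well defined\<close>

lemma mpoly_induct [case_names zero single add]:
  fixes f :: mpoly
  assumes "P 0" "\<And>m c. P (Poly_Mapping.single m c)" "\<And>f g. P f \<Longrightarrow> P g \<Longrightarrow> P (f + g)"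
  shows "P f"
proof (induction f rule: update_induct)
  case const
  then show ?case using assms(1) by simp
next
  case (update f a b)
  have "Poly_Mapping.update a b f = f + Poly_Mapping.single a b"
    using update(1) by (intro poly_mapping_eqI)
      (auto simp: lookup_update lookup_add lookup_single when_def in_keys_iff)
  then show ?case using assms update by simp
qed

abbreviation swap_exp :: "nat \<Rightarrow> (nat \<Rightarrow>\<^sub>0 nat) \<Rightarrow> (nat \<Rightarrow>\<^sub>0 nat)" where
  "swap_exp i \<equiv> Poly_Mapping.map_key (adj i)"

lemma lookup_swap_exp: "Poly_Mapping.lookup (swap_exp i m) k = Poly_Mapping.lookup m (adj i k)"
  by (simp add: map_key.rep_eq)

lemma swap_exp_swap_exp [simp]: "swap_exp i (swap_exp i m) = m"
  by (rule poly_mapping_eqI) (simp add: lookup_swap_exp)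

lemma inj_swap_exp [simp]: "inj (swap_exp i)"
  by (metis injI swap_exp_swap_exp)

lemma lookup_swap_vars: "Poly_Mapping.lookup (swap_vars i f) m = Poly_Mapping.lookup f (swap_exp i m)"
  by (simp add: swap_vars_def map_key.rep_eq)

lemma swap_exp_add: "swap_exp i (m + k) = swap_exp i m + swap_exp i k"
  by (rule poly_mapping_eqI) (simp add: lookup_swap_exp lookup_add)

lemma swap_exp_single: "swap_exp i (Poly_Mapping.single k c) = Poly_Mapping.single (adj i k) c"
  by (rule poly_mapping_eqI)
     (auto simp: lookup_swap_exp lookup_single when_def transpose_eq_iff)

lemma swap_vars_single:
  "swap_vars i (Poly_Mapping.single m c) = Poly_Mapping.single (swap_exp i m) c"
  by (rule poly_mapping_eqI) (auto simp: lookup_swap_vars lookup_single when_def)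

lemma swap_vars_add: "swap_vars i (f + g) = swap_vars i f + swap_vars i g"
  by (rule poly_mapping_eqI) (simp add: lookup_swap_vars lookup_add)

lemma swap_vars_diff: "swap_vars i (f - g) = swap_vars i f - swap_vars i g"
  by (rule poly_mapping_eqI) (simp add: lookup_swap_vars lookup_minus)

lemma swap_vars_0 [simp]: "swap_vars i 0 = 0"
  by (rule poly_mapping_eqI) (simp add: lookup_swap_vars)

lemma swap_exp_0 [simp]: "swap_exp i 0 = 0"
  by (rule poly_mapping_eqI) (simp add: lookup_swap_exp)

lemma swap_vars_1 [simp]: "swap_vars i 1 = 1"
  using swap_vars_single[of i 0 1] swap_exp_single[of i 0 0] by simp

lemma swap_vars_mult: "swap_vars i (f * g) = swap_vars i f * swap_vars i g"
proof (induction f rule: mpoly_induct)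
  case (single m c)
  show ?case
    by (induction g rule: mpoly_induct)
       (simp_all add: mult_single swap_vars_single swap_exp_add swap_vars_add distrib_left)
qed (simp_all add: distrib_right swap_vars_add)

lemma swap_vars_X: "swap_vars i (X k) = X (adj i k)"
  by (simp add: X_def xpow_def swap_vars_single swap_exp_single)

lemma swap_vars_commute:
  assumes "Suc i < j"
  shows "swap_vars i (swap_vars j f) = swap_vars j (swap_vars i f)"
proof -
  have "adj i (adj j k) = adj j (adj i k)" for k
    using assms by (auto simp: Transposition.transpose_def)
  then have "swap_exp i (swap_exp j m) = swap_exp j (swap_exp i m)" for m
    by (intro poly_mapping_eqI) (simp add: lookup_swap_exp)
  then show ?thesis by (intro poly_mapping_eqI) (simp add: lookup_swap_vars)
qed

lemma swap_vars_braid: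
  "swap_vars i (swap_vars (Suc i) (swap_vars i f)) =
   swap_vars (Suc i) (swap_vars i (swap_vars (Suc i) f))"
proof -
  have "adj i (adj (Suc i) (adj i k)) = adj (Suc i) (adj i (adj (Suc i) k))" for k
    by (auto simp: Transposition.transpose_def)
  then have "swap_exp i (swap_exp (Suc i) (swap_exp i m)) =
             swap_exp (Suc i) (swap_exp i (swap_exp (Suc i) m))" for m
    by (intro poly_mapping_eqI) (simp add: lookup_swap_exp)
  then show ?thesis by (intro poly_mapping_eqI) (simp add: lookup_swap_vars)
qed

lemma swap_vars_swap_vars [simp]: "swap_vars i (swap_vars i f) = f"
  by (intro poly_mapping_eqI) (simp add: lookup_swap_vars)

lemma X_inject [simp]: "X i = X j \<longleftrightarrow> i = j"
  unfolding X_def xpow_def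
  by (metis Poly_Mapping.keys_single singleton_inject zero_neq_one one_neq_zero insert_not_empty)

lemma diff_swap_dvd_mult:
  assumes "d dvd f - swap_vars i f" "d dvd g - swap_vars i g"
  shows "d dvd f * g - swap_vars i (f * g)"
proof -
  have "f * g - swap_vars i (f * g) =
        f * (g - swap_vars i g) + (f - swap_vars i f) * swap_vars i g"
    by (simp add: swap_vars_mult algebra_simps)
  with assms show ?thesis by (simp add: dvd_mult dvd_mult2)
qed

lemma diff_swap_dvd: "X i - X (Suc i) dvd f - swap_vars i f"
proof (induction f rule: mpoly_induct)
  case (add f g)
  have "f + g - swap_vars i (f + g) = (f - swap_vars i f) + (g - swap_vars i g)"
    by (simp add: swap_vars_add)
  with add show ?case by (metis dvd_add)
next
  case (single m c)
  have c0: "X i - X (Suc i) dvd Poly_Mapping.single 0 c - swap_vars i (Poly_Mapping.single 0 c)"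
    by (simp add: swap_vars_single)
  have var: "X i - X (Suc i) dvd X k - swap_vars i (X k)" for k
  proof -
    have "X k - swap_vars i (X k) \<in> {0, X i - X (Suc i), - (X i - X (Suc i))}"
      by (auto simp: swap_vars_X Transposition.transpose_def)
    then show ?thesis by (metis dvd_0_right dvd_minus_iff dvd_refl empty_iff insert_iff)
  qed
  have pow: "X i - X (Suc i) dvd X k ^ e - swap_vars i (X k ^ e)" for k e
    by (induction e) (auto intro: diff_swap_dvd_mult var)
  have Xpow: "X k ^ e = Poly_Mapping.single (Poly_Mapping.single k e) 1" for k e
    by (induction e) (simp_all add: X_def xpow_def mult_single flip: single_add)
  show ?case
  proof (induction m rule: update_induct)
    case const
    show ?case using c0 .
  next
    case (update m a b)
    have "Poly_Mapping.update a b m = Poly_Mapping.single a b + m"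
      using update(1) by (intro poly_mapping_eqI)
        (auto simp: lookup_update lookup_add lookup_single when_def in_keys_iff)
    then have "Poly_Mapping.single (Poly_Mapping.update a b m) c =
               X a ^ b * Poly_Mapping.single m c"
      by (simp add: Xpow mult_single)
    then show ?case using diff_swap_dvd_mult[OF pow update(3)] by simp
  qed
qed simp

lemma div_diff_unique:
  assumes "(X i - X (i + 1)) * g = f - swap_vars i f" "(X i - X (i + 1)) * h = f - swap_vars i f"
  shows "g = h"
proof -
  have "X i - X (i + 1) \<noteq> 0" by simp
  with assms show ?thesis by (metis mult_left_cancel)
qed

lemma div_diff_eq: "(X i - X (i + 1)) * div_diff i f = f - swap_vars i f"
proof -
  obtain g where g: "(X i - X (i + 1)) * g = f - swap_vars i f"
    using diff_swap_dvd[of i f] by (metis Suc_eq_plus1 dvdE)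
  show ?thesis
    unfolding div_diff_def
    by (rule theI[where P = "\<lambda>g. (X i - X (i + 1)) * g = f - swap_vars i f" and a = g])
       (use g div_diff_unique in blast)+
qed

text \<open>
  Both operators are instances of \<open>gen_diff c\<close>, for \<open>c = 0\<close> and \<open>c = 1\<close>.
\<close>

definition gen_diff :: "mpoly \<Rightarrow> nat \<Rightarrow> mpoly \<Rightarrow> mpoly" where
  "gen_diff c i f = div_diff i ((1 - c * X (i + 1)) * f)"

lemma div_diff_conv_gen: "div_diff = gen_diff 0"
  by (intro ext) (simp add: gen_diff_def)

lemma K_div_diff_conv_gen: "K_div_diff = gen_diff 1"
  by (intro ext) (simp add: gen_diff_def K_div_diff_def)

context
  fixes c :: mpoly
  assumes c [simp]: "\<And>i. swap_vars i c = c"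
begin

lemma gen_diff_eq:
  "(X i - X (Suc i)) * gen_diff c i f =
     (1 - c * X (Suc i)) * f - (1 - c * X i) * swap_vars i f"
  unfolding gen_diff_def using div_diff_eq[of i "(1 - c * X (i + 1)) * f"]
  by (simp add: swap_vars_mult swap_vars_diff swap_vars_X)

lemma swap_gen_diff_eq:
  "(X (adj j i) - X (adj j (Suc i))) * swap_vars j (gen_diff c i f) =
     (1 - c * X (adj j (Suc i))) * swap_vars j f
     - (1 - c * X (adj j i)) * swap_vars j (swap_vars i f)"
  using arg_cong[OF gen_diff_eq[of i f], of "swap_vars j"]
  by (simp add: swap_vars_mult swap_vars_diff swap_vars_X)

lemma gen_diff_commute:
  assumes "Suc i < j"
  shows "gen_diff c i (gen_diff c j f) = gen_diff c j (gen_diff c i f)" (is "?l = ?r")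
proof -
  let ?d = "X i - X (Suc i)" and ?e = "X j - X (Suc j)"
  have a: "adj i j = j" "adj i (Suc j) = Suc j" "adj j i = i" "adj j (Suc i) = Suc i"
    using assms by (auto simp: Transposition.transpose_def)
  note e1 = gen_diff_eq[of i "gen_diff c j f"] gen_diff_eq[of j f]
    swap_gen_diff_eq[of i j f, unfolded a]
  note e2 = gen_diff_eq[of j "gen_diff c i f"] gen_diff_eq[of i f]
    swap_gen_diff_eq[of j i f, unfolded a]
  have "?d * ?e * ?l = ?d * ?e * ?r"
    using e1 e2 swap_vars_commute[OF assms, of f] by algebra
  moreover have "?d * ?e \<noteq> 0" by simp
  ultimately show ?thesis by (metis mult_left_cancel)
qed

lemma gen_diff_braid:
  "gen_diff c i (gen_diff c (Suc i) (gen_diff c i f)) =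
   gen_diff c (Suc i) (gen_diff c i (gen_diff c (Suc i) f))" (is "?l = ?r")
proof -
  define x y z where "x = X i" and "y = X (Suc i)" and "z = X (Suc (Suc i))"
  define p q r where "p = 1 - c * x" and "q = 1 - c * y" and "r = 1 - c * z"
  have ne: "x - y \<noteq> 0" "y - z \<noteq> 0" "x - z \<noteq> 0" by (simp_all add: x_def y_def z_def)
  have a: "adj i i = Suc i" "adj i (Suc i) = i" "adj i (Suc (Suc i)) = Suc (Suc i)"
    "adj (Suc i) i = i" "adj (Suc i) (Suc i) = Suc (Suc i)"
    "adj (Suc i) (Suc (Suc i)) = Suc i"
    by (auto simp: Transposition.transpose_def)
  let ?s = "swap_vars i" and ?t = "swap_vars (Suc i)"
  let ?S = "gen_diff c i" and ?T = "gen_diff c (Suc i)"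
  have S: "(x - y) * ?S g = q * g - p * ?s g" for g
    using gen_diff_eq[of i g] by (simp add: x_def y_def p_def q_def)
  have T: "(y - z) * ?T g = r * g - q * ?t g" for g
    using gen_diff_eq[of "Suc i" g] by (simp add: z_def y_def r_def q_def)
  have tS: "(x - z) * ?t (?S g) = r * ?t g - p * ?t (?s g)" for g
    using swap_gen_diff_eq[of "Suc i" i g] by (simp add: a x_def z_def p_def r_def)
  have sT: "(x - z) * ?s (?T g) = r * ?s g - p * ?s (?t g)" for g
    using swap_gen_diff_eq[of i "Suc i" g] by (simp add: a x_def z_def p_def r_def)
  let ?R = "q * r ^ 2 * f - p * r ^ 2 * ?s f - r * q ^ 2 * ?t f + p * q ^ 2 * ?t (?s f)
            + r * p ^ 2 * ?s (?t f) - q * p ^ 2 * ?s (?t (?s f))"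
  define D where "D = (x - y) * (y - z) * (x - z)"
  have l: "D * ?l = ?R"
  proof -
    have "(y - z) * (x - z) * (x - y) * ?T (?S f) =
      (x - z) * r * (q * f - p * ?s f) - q * (x - y) * (r * ?t f - p * ?t (?s f))"
      using T[of "?S f"] S[of f] tS[of f] by algebra
    moreover from this have "(x - z) * (y - z) * (y - x) * ?s (?T (?S f)) =
      (y - z) * r * (p * ?s f - q * f) - p * (y - x) * (r * ?s (?t f) - q * ?s (?t (?s f)))"
      by (drule_tac arg_cong[of _ _ ?s])
         (simp add: swap_vars_mult swap_vars_diff swap_vars_X a x_def y_def z_def
           p_def q_def r_def)
    ultimately have "(x - y) * (D * ?l) = (x - y) * ?R"
      using S[of "?T (?S f)"] D_def p_def q_def r_def by algebra
    then show ?thesis using ne by simp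
  qed
  have r: "D * ?r = ?R"
  proof -
    have "(x - y) * (x - z) * (y - z) * ?S (?T f) =
      (x - z) * q * (r * f - q * ?t f) - p * (y - z) * (r * ?s f - p * ?s (?t f))"
      using S[of "?T f"] T[of f] sT[of f] by algebra
    moreover from this have "(x - z) * (x - y) * (z - y) * ?t (?S (?T f)) =
      (x - y) * r * (q * ?t f - r * f) - p * (z - y) * (q * ?t (?s f) - p * ?t (?s (?t f)))"
      by (drule_tac arg_cong[of _ _ ?t])
         (simp add: swap_vars_mult swap_vars_diff swap_vars_X a x_def y_def z_def
           p_def q_def r_def)
    ultimately have "(y - z) * (D * ?r) = (y - z) * ?R"
      using T[of "?S (?T f)"] D_def p_def q_def r_def swap_vars_braid[of i f] by algebra
    then show ?thesis using ne by simp
  qed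
  have "D \<noteq> 0" using ne by (simp add: D_def)
  with l r show ?thesis by (metis mult_left_cancel)
qed

end

lemma adj_permutes:
  assumes "w permutes {1..n}" "1 \<le> i" "i < n"
  shows "w \<circ> adj i permutes {1..n}"
  using assms by (intro permutes_compose permutes_swap_id) auto

abbreviation inversions :: "nat \<Rightarrow> (nat \<Rightarrow> nat) \<Rightarrow> (nat \<times> nat) set" where
  "inversions n w \<equiv> {(i, j). i \<in> {1..n} \<and> j \<in> {1..n} \<and> i < j \<and> w j < w i}"

lemma finite_inversions: "finite (inversions n w)"
  by (rule finite_subset[of _ "{1..n} \<times> {1..n}"]) auto

lemma perm_length_le: "perm_length n w \<le> perm_length n (longest_perm n)"
  unfolding perm_length_def
  by (intro card_mono finite_inversions) (auto simp: longest_perm_def)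

lemma perm_length_ascent:
  assumes "1 \<le> i" "i < n" "w i < w (Suc i)"
  shows "perm_length n w < perm_length n (w \<circ> adj i)"
proof -
  let ?h = "\<lambda>(p, q). (adj i p, adj i q)"
  have "inj_on ?h (inversions n w)"
    by (auto simp: inj_on_def dest: injD[OF inj_transpose])
  then have "perm_length n w = card (?h ` inversions n w)"
    by (simp add: perm_length_def card_image)
  also have "\<dots> < card (inversions n (w \<circ> adj i))"
  proof (rule psubset_card_mono[OF finite_inversions])
    have "?h ` inversions n w \<subseteq> inversions n (w \<circ> adj i)"
    proof
      fix z assume "z \<in> ?h ` inversions n w"
      then obtain p q where pq: "z = (adj i p, adj i q)" "p \<in> {1..n}" "q \<in> {1..n}"
        "p < q" "w q < w p" by auto
      have "\<not> (p = i \<and> q = Suc i)" using pq assms by auto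
      then show "z \<in> inversions n (w \<circ> adj i)"
        using pq assms by (auto simp: Transposition.transpose_def)
    qed
    moreover have "(i, Suc i) \<in> inversions n (w \<circ> adj i)" using assms by auto
    moreover have "(i, Suc i) \<notin> ?h ` inversions n w"
      by (auto simp: Transposition.transpose_def split: if_splits)
    ultimately show "?h ` inversions n w \<subset> inversions n (w \<circ> adj i)" by blast
  qed
  finally show ?thesis by (simp add: perm_length_def)
qed

lemma perm_length_less_iff:
  assumes "w permutes {1..n}" "1 \<le> i" "i < n"
  shows "perm_length n w < perm_length n (w \<circ> adj i) \<longleftrightarrow> w i < w (Suc i)"
proof -
  have "w i \<noteq> w (Suc i)" using permutes_inj[OF assms(1)] by (simp add: inj_eq)
  moreover have "w \<circ> adj i \<circ> adj i = w" by (simp add: comp_assoc)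
  ultimately show ?thesis
    using assms perm_length_ascent[of i n w] perm_length_ascent[of i n "w \<circ> adj i"]
    by (cases "w i < w (Suc i)") auto
qed

lemma no_ascent_imp_longest:
  assumes w: "w permutes {1..n}" and na: "\<And>i. 1 \<le> i \<Longrightarrow> i < n \<Longrightarrow> \<not> w i < w (Suc i)"
  shows "w = longest_perm n"
proof
  fix k
  have dec: "w (Suc i) < w i" if "1 \<le> i" "i < n" for i
    using na[OF that] permutes_inj[OF w] by (metis inj_eq linorder_neqE_nat n_not_Suc_n)
  have rng: "w i \<in> {1..n}" if "i \<in> {1..n}" for i
    using permutes_in_image[OF w] that by blast
  show "w k = longest_perm n k"
  proof (cases "k \<in> {1..n}")
    case False
    then show ?thesis using permutes_not_in[OF w] by (auto simp: longest_perm_def)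
  next
    case True
    have "1 \<le> i \<Longrightarrow> i \<le> n \<Longrightarrow> w i + i \<le> n + 1" for i
    proof (induction i rule: nat_induct)
      case (Suc i)
      then show ?case using dec[of i] rng[of "Suc i"] by (cases "i = 0") auto
    qed simp
    moreover have "j < n \<Longrightarrow> w (n - j) \<ge> j + 1" for j
    proof (induction j)
      case 0
      then show ?case using rng[of n] by simp
    next
      case (Suc j)
      then have "n - Suc j \<ge> 1" "n - Suc j < n" "Suc (n - Suc j) = n - j" by auto
      then show ?case using dec[of "n - Suc j"] Suc by simp
    qed
    from this[of "n - k"] have "w k \<ge> n - k + 1" using True by auto
    ultimately have "w k = n + 1 - k" using True by (metis Suc_diff_le Suc_eq_plus1
      add_le_imp_le_diff atLeastAtMost_iff le_antisym)
    then show ?thesis using True by (simp add: longest_perm_def)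
  qed
qed

lemma op_chain_ex:
  assumes "w permutes {1..n}"
  shows "\<exists>f. op_chain op n w f"
  using assms
proof (induction "perm_length n (longest_perm n) - perm_length n w" arbitrary: w
    rule: less_induct)
  case less
  show ?case
  proof (cases "\<exists>i. 1 \<le> i \<and> i < n \<and> w i < w (Suc i)")
    case True
    then obtain i where i: "1 \<le> i" "i < n" "w i < w (Suc i)" by auto
    have lt: "perm_length n w < perm_length n (w \<circ> adj i)"
      using perm_length_ascent[OF i] .
    then obtain f where "op_chain op n (w \<circ> adj i) f"
      using less.hyps[OF _ adj_permutes[OF less.prems i(1,2)]]
        perm_length_le[of n "w \<circ> adj i"] by (meson diff_less_mono2 less_le_trans)
    then show ?thesis using op_chain.step less.prems i lt by blast
  next
    case False
    then have "w = longest_perm n" using no_ascent_imp_longest[OF less.prems] by blast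
    then show ?thesis using op_chain.longest by blast
  qed
qed

lemma op_chain_unique:
  assumes com: "\<And>i j f. Suc i < j \<Longrightarrow> op i (op j f) = op j (op i f)"
    and braid: "\<And>i f. op i (op (Suc i) (op i f)) = op (Suc i) (op i (op (Suc i) f))"
  assumes "w permutes {1..n}" "op_chain op n w f" "op_chain op n w g"
  shows "f = g"
  using assms(3-)
proof (induction "perm_length n (longest_perm n) - perm_length n w" arbitrary: w f g
    rule: less_induct)
  case less
  have IH: "f' = g'" if "1 \<le> i" "i < n" "perm_length n w < perm_length n (w \<circ> adj i)"
    "op_chain op n (w \<circ> adj i) f'" "op_chain op n (w \<circ> adj i) g'" for i f' g'
  proof (rule less.hyps[OF _ adj_permutes[OF less.prems(1) that(1,2)] that(4,5)])
    show "perm_length n (longest_perm n) - perm_length n (w \<circ> adj i)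
          < perm_length n (longest_perm n) - perm_length n w"
      using that(3) perm_length_le[of n "w \<circ> adj i"] by linarith
  qed
  have confl: "op i f' = op j g'"
    if ij: "i < j" "1 \<le> i" "j < n"
      and i: "perm_length n w < perm_length n (w \<circ> adj i)" "op_chain op n (w \<circ> adj i) f'"
      and j: "perm_length n w < perm_length n (w \<circ> adj j)" "op_chain op n (w \<circ> adj j) g'"
    for i j f' g'
  proof -
    have ij': "i < n" "1 \<le> j" "1 \<le> Suc i" using ij by auto
    note perm = less.prems(1) adj_permutes
    have wi: "w i < w (Suc i)" and wj: "w j < w (Suc j)"
      using i(1) j(1) perm_length_less_iff[OF less.prems(1)] ij ij' by auto
    show ?thesis
    proof (cases "j = Suc i")
      case False
      have eq: "w \<circ> adj i \<circ> adj j = w \<circ> adj j \<circ> adj i"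
        using ij False by (auto simp: fun_eq_iff Transposition.transpose_def)
      obtain k where k: "op_chain op n (w \<circ> adj i \<circ> adj j) k"
        using op_chain_ex perm ij ij' by metis
      have "op_chain op n (w \<circ> adj i) (op j k)"
        using ij ij' wj False
        by (intro step k perm perm_length_ascent) (auto simp: Transposition.transpose_def)
      moreover have "op_chain op n (w \<circ> adj j) (op i k)"
        using ij ij' wi False k unfolding eq
        by (intro step perm perm_length_ascent) (auto simp: Transposition.transpose_def)
      ultimately show ?thesis
        using IH i j ij ij' com[of i j k] False by (metis Suc_lessI)
    next
      case True
      let ?s = "adj i" and ?t = "adj (Suc i)"
      have eq: "w \<circ> ?s \<circ> ?t \<circ> ?s = w \<circ> ?t \<circ> ?s \<circ> ?t"
        by (auto simp: fun_eq_iff Transposition.transpose_def)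
      have j': "w (Suc i) < w (Suc (Suc i))" "Suc i < n" using wj ij True by auto
      obtain k where k: "op_chain op n (w \<circ> ?s \<circ> ?t \<circ> ?s) k"
        using op_chain_ex perm ij ij' j' by metis
      have "op_chain op n (w \<circ> ?s) (op (Suc i) (op i k))"
        using ij' ij wi j'
        by (intro step k perm perm_length_ascent) (auto simp: Transposition.transpose_def)
      moreover have "op_chain op n (w \<circ> ?t) (op i (op (Suc i) k))"
        using ij' ij wi j' k unfolding eq
        by (intro step perm perm_length_ascent) (auto simp: Transposition.transpose_def)
      ultimately show ?thesis
        using IH i j ij ij' braid[of i k] True by metis
    qed
  qed
  have top: "\<not> perm_length n (longest_perm n) < perm_length n (longest_perm n \<circ> adj i)" for i
    using perm_length_le[of n "longest_perm n \<circ> adj i"] by simp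
  from less.prems(2) show ?case
  proof cases
    case longest
    from less.prems(3) show ?thesis by cases (use longest top in auto)
  next
    case (step i f')
    note f = step
    from less.prems(3) show ?thesis
    proof cases
      case longest
      then show ?thesis using f top by auto
    next
      case (step j g')
      consider "i < j" | "j < i" | "i = j" by linarith
      then show ?thesis
      proof cases
        case 1
        then show ?thesis using f step confl[of i j f' g'] by simp
      next
        case 2
        then show ?thesis using f step confl[of j i g' f'] by simp
      next
        case 3
        then show ?thesis using f step IH[of i f' g'] by simp
      qed
    qed
  qed
qed

lemma op_chain_gen_diff_unique:
  assumes c: "\<And>i. swap_vars i c = c" and w: "w permutes {1..n}"
    and "op_chain (gen_diff c) n w f" "op_chain (gen_diff c) n w g"
  shows "f = g"
proof (rule op_chain_unique[where op = "gen_diff c", OF _ _ assms(2-)])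
  show "gen_diff c i (gen_diff c j f) = gen_diff c j (gen_diff c i f)" if "Suc i < j" for i j f
    using gen_diff_commute[OF c that] .
  show "gen_diff c i (gen_diff c (Suc i) (gen_diff c i f)) =
        gen_diff c (Suc i) (gen_diff c i (gen_diff c (Suc i) f))" for i f
    using gen_diff_braid[OF c] .
qed

lemma op_chain_gen_diff_the:
  assumes c: "\<And>i. swap_vars i c = c" and w: "w permutes {1..n}"
  shows "op_chain (gen_diff c) n w (THE f. op_chain (gen_diff c) n w f)"
proof -
  obtain f where f: "op_chain (gen_diff c) n w f" using op_chain_ex[OF w] by blast
  show ?thesis by (rule theI[of "op_chain (gen_diff c) n w", OF f])
    (rule op_chain_gen_diff_unique[OF c w _ f])
qed

lemma op_chain_schubert: "w permutes {1..n} \<Longrightarrow> op_chain div_diff n w (schubert n w)"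
  unfolding schubert_def div_diff_conv_gen by (rule op_chain_gen_diff_the) auto

lemma op_chain_grothendieck:
  "w permutes {1..n} \<Longrightarrow> op_chain K_div_diff n w (grothendieck n w)"
  unfolding grothendieck_def K_div_diff_conv_gen by (rule op_chain_gen_diff_the) auto

lemma schubert_eqI:
  assumes "w permutes {1..n}" "op_chain div_diff n w f"
  shows "schubert n w = f"
  using op_chain_gen_diff_unique[of 0 w n] op_chain_schubert assms
  by (simp add: div_diff_conv_gen)

lemma grothendieck_eqI:
  assumes "w permutes {1..n}" "op_chain K_div_diff n w f"
  shows "grothendieck n w = f"
  using op_chain_gen_diff_unique[of 1 w n] op_chain_grothendieck assms
  by (simp add: K_div_diff_conv_gen)

lemma longest_perm_permutes: "longest_perm n permutes {1..n}"
  by (rule bij_imp_permutes, rule bij_betw_byWitness[where f' = "longest_perm n"])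
     (auto simp: longest_perm_def)

lemma schubert_longest: "schubert n (longest_perm n) = (\<Prod>i = 1..n. X i ^ (n - i))"
  by (intro schubert_eqI longest_perm_permutes op_chain.longest)

lemma grothendieck_longest: "grothendieck n (longest_perm n) = (\<Prod>i = 1..n. X i ^ (n - i))"
  by (intro grothendieck_eqI longest_perm_permutes op_chain.longest)

lemma schubert_step:
  assumes "w permutes {1..n}" "1 \<le> i" "i < n" "perm_length n w < perm_length n (w \<circ> adj i)"
  shows "schubert n w = div_diff i (schubert n (w \<circ> adj i))"
  using assms by (intro schubert_eqI op_chain.step op_chain_schubert adj_permutes)

lemma grothendieck_step:
  assumes "w permutes {1..n}" "1 \<le> i" "i < n" "perm_length n w < perm_length n (w \<circ> adj i)"
  shows "grothendieck n w = K_div_diff i (grothendieck n (w \<circ> adj i))"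
  using assms by (intro grothendieck_eqI op_chain.step op_chain_grothendieck adj_permutes)

end

theory Submission
  imports Defs
begin

text \<open>
  Up to signs the coefficients of $\mathfrak G_w$ are those of a polynomial with nonnegative
  coefficients: the coefficient of $T_w$ in $A_1(x_1)A_2(x_2)\cdots A_n(x_n)$, where
  $A_k(x)=(1+xT_{n-1})\cdots(1+xT_{k+1})(1+xT_k)$ and the $T_i$ generate the $0$-Hecke algebra
  ($T_i^2=T_i$ and the braid relations).  This is the pipe dream formula.  Below it is \<open>pos_groth n w\<close>,
  and \<open>supp_grothendieck\<close> says that it has the support of $\mathfrak G_w$.  As there is no
  cancellation, statements about supports can be argued set-theoretically.

  For a fireworks permutation the $j$-th entry of the weight of the closed diagram is the number
  $d_j(w)$ of descents of $w$ at positions at least $j$ (\<open>wt_rothe_closure\<close>).  So the first claim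
  follows if the support is saturated with respect to $d(w)$: the exponent of $x_j$ never
  exceeds $d_j(w)$, and in any monomial of the support an exponent smaller than $d_j(w)$ can be
  raised by one (\<open>saturated_pos_groth\<close>).

  Saturation is proved by induction on $n$, deleting the entry $1$ of $w$.  If $1$ stands at position $p$ and
  $u \in S_{n-1}$ is what remains, then
  $G_w = x_1\cdots x_{p-1}\,\pi_p\pi_{p+1}\cdots\pi_{n-1}G_u$ for the positive versions, with the
  isobaric operators $\pi_i f = \partial_i\bigl(x_i(1+x_{i+1})f\bigr)$; the intermediate polynomials have a
  row description of their own, \<open>delayed_rows\<close> (\<open>pos_groth_delete_one\<close>).  On the side of the bounds,
  each $\pi_i$ replaces the pair $(d_i,d_{i+1})$ by $(d_i,d_i)$.  The fireworks condition enters here: if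
  $1$ is neither the first nor the last entry, then its neighbours satisfy $w(p-1)<w(p+1)$, so that
  exactly one descent is lost with the entry $1$ (\<open>delete_one_descents\<close>).

  It remains to see that a single $\pi_i$ respects saturation (\<open>saturated_demazure_pair\<close>).  What is
  needed about the supports of $f$ and $\pi_i f$ is collected in \<open>demazure_pair\<close>: every monomial of $\pi_i f$ has a
  source in $f$ at least as unbalanced in $x_i, x_{i+1}$, and along each diagonal
  $x_i^{a}x_{i+1}^{b}$, $a+b$ constant, the support of $\pi_i f$ is symmetric and without gaps.  The
  absence of gaps comes from a recursion for $A_k(x)A_k(y)$ in terms of $A_{k+1}(x)A_{k+1}(y)$
  (\<open>double_row\<close>), which also shows that $A_k(x)$ and $A_k(y)$ commute.

  For the description of the whole support, every monomial of $G_w$ of degree above $\ell(w)$ is a variable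
  times another monomial of $G_w$ (\<open>generated_in_low_degree_rows\<close>), and the part of degree $\ell(w)$
  is $\mathfrak S_w$ (\<open>schubert_lowest_part\<close>).  So each monomial lies above one of
  $\mathfrak S_w$, and saturation fills the boxes.
\<close>

section \<open>The right action of the 0-Hecke algebra\<close>

type_synonym vec = "(nat \<Rightarrow> nat) \<Rightarrow> mpoly"

text \<open>
  A vector \<open>v\<close> stands for the formal sum $\sum_w v(w)\,T_w$, and \<open>hecke n i v\<close> is its product with $T_i$ from
  the right: $T_wT_i$ is $T_w$ at a descent and $T_{ws_i}$ at an ascent.  With $T_i=0$ for $i\ge n$ the
  defining relations remain true, so that no recursion over the generators needs a special case at the end.
\<close>

definition hecke :: "nat \<Rightarrow> nat \<Rightarrow> vec \<Rightarrow> vec" where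
  "hecke n i v w = (if i < n \<and> w (Suc i) < w i then v w + v (w \<circ> adj i) else 0)"

definition hecke_step :: "nat \<Rightarrow> nat \<Rightarrow> mpoly \<Rightarrow> vec \<Rightarrow> vec" where
  "hecke_step n i x v w = v w + x * hecke n i v w"

text \<open>
  Multiplication by $A_k(x)=(1+xT_{n-1})\cdots(1+xT_k)$ from the right; the leftmost factor acts first.
\<close>

definition row :: "nat \<Rightarrow> nat \<Rightarrow> mpoly \<Rightarrow> vec \<Rightarrow> vec" where
  "row n k x = fold (\<lambda>i. hecke_step n i x) (rev [k..<n])"

lemma adj_comp_adj [simp]: "w \<circ> adj i \<circ> adj i = w"
  by (simp add: comp_assoc)

lemma adj_comp_commute: "Suc i < j \<Longrightarrow> w \<circ> adj j \<circ> adj i = w \<circ> adj i \<circ> adj j"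
  by (auto simp: fun_eq_iff Transposition.transpose_def)

lemma adj_comp_braid: "w \<circ> adj (Suc i) \<circ> adj i \<circ> adj (Suc i) = w \<circ> adj i \<circ> adj (Suc i) \<circ> adj i"
  by (auto simp: fun_eq_iff Transposition.transpose_def)

lemma hecke_add: "hecke n i (\<lambda>w. f w + g w) = (\<lambda>w. hecke n i f w + hecke n i g w)"
  by (rule ext) (simp add: hecke_def)

lemma hecke_mult: "hecke n i (\<lambda>w. c * f w) = (\<lambda>w. c * hecke n i f w)"
  by (rule ext) (simp add: hecke_def distrib_left)

lemma hecke_diff: "hecke n i (\<lambda>w. f w - g w) = (\<lambda>w. hecke n i f w - hecke n i g w)"
  by (rule ext) (simp add: hecke_def)

lemma hecke_idem: "hecke n i (hecke n i f) = hecke n i f"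
  by (rule ext) (auto simp: hecke_def)

lemma hecke_commute:
  assumes "Suc i < j"
  shows "hecke n j (hecke n i f) = hecke n i (hecke n j f)"
  using assms
  by (intro ext) (auto simp: hecke_def Transposition.transpose_def adj_comp_commute[OF assms])

lemma hecke_braid:
  "hecke n (Suc i) (hecke n i (hecke n (Suc i) f)) = hecke n i (hecke n (Suc i) (hecke n i f))"
proof
  fix w :: "nat \<Rightarrow> nat"
  have a: "(w \<circ> adj j) k = w (adj j k)" for j k w by simp
  have t: "adj i i = Suc i" "adj i (Suc i) = i" "adj i (Suc (Suc i)) = Suc (Suc i)"
    "adj (Suc i) i = i" "adj (Suc i) (Suc i) = Suc (Suc i)" "adj (Suc i) (Suc (Suc i)) = Suc i"
    by (auto simp: Transposition.transpose_def)
  consider "w i < w (Suc i)" | "w i = w (Suc i)" | "w (Suc i) < w i" by linarith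
  then show "hecke n (Suc i) (hecke n i (hecke n (Suc i) f)) w
      = hecke n i (hecke n (Suc i) (hecke n i f)) w"
  proof cases
    case 1
    consider "w i < w (Suc (Suc i))" | "w i = w (Suc (Suc i))" | "w (Suc (Suc i)) < w i" by linarith
    then show ?thesis using 1
      by cases (simp_all only: hecke_def a t adj_comp_adj adj_comp_braid, auto simp: algebra_simps)
  next
    case 2
    then show ?thesis 
      by (simp only: hecke_def a t adj_comp_adj adj_comp_braid, auto simp: algebra_simps)
  next
    case 3
    consider "w (Suc i) < w (Suc (Suc i))" | "w (Suc i) = w (Suc (Suc i))" | "w (Suc (Suc i)) < w (Suc i)" by linarith
    then show ?thesis using 3
      by cases (simp_all only: hecke_def a t adj_comp_adj adj_comp_braid, auto simp: algebra_simps)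
  qed
qed

lemmas hecke_linear = hecke_add hecke_mult hecke_diff

lemma hecke_step_eq: "hecke_step n i x v = (\<lambda>w. v w + x * hecke n i v w)"
  by (rule ext) (simp add: hecke_step_def)

lemma hecke_step_trivial: "n \<le> i \<Longrightarrow> hecke_step n i x v = v"
  by (rule ext) (simp add: hecke_step_def hecke_def)

lemma hecke_step_commute:
  assumes "Suc i < j"
  shows "hecke_step n j y (hecke_step n i x f) = hecke_step n i x (hecke_step n j y f)"
  by (simp add: hecke_step_eq hecke_linear hecke_commute[OF assms] algebra_simps)

lemma row_unfold: "row n k x v = hecke_step n k x (row n (Suc k) x v)"
proof (cases "k < n")
  case True
  then show ?thesis by (simp add: row_def upt_conv_Cons)
next
  case False
  then show ?thesis by (simp add: row_def hecke_step_trivial)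
qed

lemma row_trivial: "n \<le> k \<Longrightarrow> row n k x v = v"
  by (simp add: row_def)

lemma row_induct [consumes 0, case_names top step]:
  assumes "\<And>k. n \<le> k \<Longrightarrow> P k" "\<And>k. k < n \<Longrightarrow> P (Suc k) \<Longrightarrow> P k"
  shows "P (k::nat)"
proof (induction "n - k" arbitrary: k)
  case 0
  then show ?case using assms(1) by simp
next
  case (Suc d)
  then have "k < n" "d = n - Suc k" by auto
  then show ?case using assms(2) Suc(1) by blast
qed

lemma row_hecke_step_commute:
  assumes "Suc i < k"
  shows "row n k x (hecke_step n i y f) = hecke_step n i y (row n k x f)"
  using assms
proof (induction k rule: row_induct[where n = n])
  case (top k)
  then show ?case by (simp add: row_trivial)
next
  case (step k)
  then show ?case
    by (subst (1 2) row_unfold) (simp add: hecke_step_commute)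
qed

text \<open>
  Write $A_k(x)A_k(y) = A_{k+1}(x)A_{k+2}(y)\,(1+xT_k)(1+yT_{k+1})(1+yT_k)$, using that $T_k$ commutes with
  $A_{k+2}$, and expand with the braid relation.  The term with $T_kT_{k+1}T_k=T_{k+1}T_kT_{k+1}$ is absorbed by
  $f\,yT_{k+1}=C-f$.  The first form has nonnegative coefficients and serves the study of supports;
  the second is visibly symmetric in \<open>x\<close> and \<open>y\<close> as soon as \<open>C\<close> is.
\<close>

lemma double_row:
  fixes n k x y v
  defines "C \<equiv> row n (Suc k) y (row n (Suc k) x v)"
    and "f \<equiv> row n (Suc (Suc k)) y (row n (Suc k) x v)"
  shows "row n k y (row n k x v) = (\<lambda>w. C w + x * y * hecke n (Suc k) (hecke n k C) w
           + (y * hecke n k C w + x * (1 + y) * hecke n k f w))" (is ?t1)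
    and "row n k y (row n k x v) = (\<lambda>w. C w + x * y * hecke n (Suc k) (hecke n k C) w
           + (x + y + x * y) * hecke n k C w - x * y * hecke n k (hecke n (Suc k) C) w)" (is ?t2)
    and "C = hecke_step n (Suc k) y f"
proof -
  show C: "C = hecke_step n (Suc k) y f"
    unfolding C_def f_def by (subst row_unfold) simp
  have "row n k y (row n k x v) = hecke_step n k y (hecke_step n (Suc k) y (row n (Suc (Suc k)) y (hecke_step n k x (row n (Suc k) x v))))"
    by (metis row_unfold)
  also have "\<dots> = hecke_step n k y (hecke_step n (Suc k) y (hecke_step n k x f))"
    by (simp add: row_hecke_step_commute f_def)
  finally have *: "row n k y (row n k x v) = hecke_step n k y (hecke_step n (Suc k) y (hecke_step n k x f))" .
  show ?t1 unfolding * C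
    by (simp add: hecke_step_eq hecke_linear hecke_idem hecke_braid algebra_simps)
  show ?t2 unfolding * C
    by (simp add: hecke_step_eq hecke_linear hecke_idem hecke_braid algebra_simps)
qed

lemma row_commute: "row n k y (row n k x v) = row n k x (row n k y v)"
proof (induction k rule: row_induct[where n = n])
  case (top k)
  then show ?case by (simp add: row_trivial)
next
  case (step k)
  show ?case
    unfolding double_row(2)[of n k] step
    by (simp add: algebra_simps)
qed

section \<open>Supports of polynomials with nonnegative coefficients\<close>

abbreviation lookup where "lookup \<equiv> Poly_Mapping.lookup"

definition unit_exp :: "nat \<Rightarrow> (nat \<Rightarrow>\<^sub>0 nat)" where "unit_exp j = Poly_Mapping.single j 1"

lemma lookup_unit_exp [simp]: "lookup (unit_exp j) k = (if j = k then 1 else 0)"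
  by (simp add: unit_exp_def lookup_single when_def)

lemma X_unit_exp: "X i = Poly_Mapping.single (unit_exp i) 1"
  by (simp add: X_def xpow_def unit_exp_def)

lemma swap_exp_unit_exp: "swap_exp i (unit_exp j) = unit_exp (adj i j)"
  by (simp add: unit_exp_def swap_exp_single)

lemma lookup_X_mult: "lookup (X i * f) (m + unit_exp i) = lookup f m"
proof (induction f rule: mpoly_induct)
  case (single k c)
  have "(unit_exp i + k = m + unit_exp i) \<longleftrightarrow> k = m" by (simp add: add.commute)
  then show ?case by (simp add: X_unit_exp mult_single lookup_single when_def)
qed (simp_all add: distrib_left lookup_add)

lemma lookup_X_mult_not:
  assumes "lookup m i = 0"
  shows "lookup (X i * f) m = 0"
proof (induction f rule: mpoly_induct)
  case (single k c)
  have "unit_exp i + k \<noteq> m" using assms by (auto simp: lookup_add)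
  then show ?case by (simp add: X_unit_exp mult_single lookup_single when_def)
qed (simp_all add: distrib_left lookup_add)

lemma exp_split:
  assumes "lookup m i \<noteq> 0"
  obtains k where "m = k + unit_exp i"
proof
  show "m = (m - unit_exp i) + unit_exp i"
    using assms by (intro poly_mapping_eqI) (auto simp: lookup_add lookup_minus)
qed

lemma exp_add_eq:
  assumes "m + unit_exp i = k + unit_exp j" "i \<noteq> j"
  obtains r where "m = r + unit_exp j" "k = r + unit_exp i"
proof -
  have "lookup (m + unit_exp i) j = lookup (k + unit_exp j) j" using assms by simp
  then have "lookup m j \<noteq> 0" using assms(2) by (simp add: lookup_add)
  then obtain r where r: "m = r + unit_exp j" by (rule exp_split)
  then have "r + unit_exp i + unit_exp j = k + unit_exp j" using assms(1) by (simp add: ac_simps)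
  then have "k = r + unit_exp i" by simp
  with r show ?thesis using that by blast
qed

definition shift :: "nat \<Rightarrow> (nat \<Rightarrow>\<^sub>0 nat) set \<Rightarrow> (nat \<Rightarrow>\<^sub>0 nat) set" where
  "shift j S = (\<lambda>m. m + unit_exp j) ` S"

lemma supp_X_mult: "supp (X i * f) = shift i (supp f)"
proof (rule set_eqI)
  fix m
  show "m \<in> supp (X i * f) \<longleftrightarrow> m \<in> shift i (supp f)"
  proof (cases "lookup m i = 0")
    case True
    then have "m \<notin> shift i (supp f)" by (auto simp: shift_def lookup_add)
    with True show ?thesis by (simp add: in_keys_iff lookup_X_mult_not)
  next
    case False
    then obtain k where "m = k + unit_exp i" by (rule exp_split)
    then show ?thesis by (auto simp: in_keys_iff lookup_X_mult shift_def)
  qed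
qed

definition nonneg :: "mpoly \<Rightarrow> bool" where
  "nonneg f \<longleftrightarrow> (\<forall>m. 0 \<le> lookup f m)"

lemma nonneg_0 [simp]: "nonneg 0" by (simp add: nonneg_def)

lemma nonneg_add: "nonneg f \<Longrightarrow> nonneg g \<Longrightarrow> nonneg (f + g)"
  by (simp add: nonneg_def lookup_add)

lemma nonneg_X_mult: "nonneg f \<Longrightarrow> nonneg (X i * f)"
  unfolding nonneg_def by (metis exp_split lookup_X_mult lookup_X_mult_not order_refl)

lemma supp_add: "nonneg f \<Longrightarrow> nonneg g \<Longrightarrow> supp (f + g) = supp f \<union> supp g"
  by (auto simp: nonneg_def in_keys_iff lookup_add add_nonneg_eq_0_iff)

lemma supp_swap: "m \<in> supp (swap_vars i f) \<longleftrightarrow> swap_exp i m \<in> supp f"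
  by (simp add: in_keys_iff lookup_swap_vars)

lemma nonneg_hecke: "(\<And>w. nonneg (v w)) \<Longrightarrow> nonneg (hecke n k v w)"
  by (simp add: hecke_def nonneg_add)

lemma nonneg_hecke_step: "(\<And>w. nonneg (v w)) \<Longrightarrow> nonneg (hecke_step n k (X j) v w)"
  by (simp add: hecke_step_def nonneg_add nonneg_X_mult nonneg_hecke)

lemma row_preserves:
  assumes "\<And>k v. P v \<Longrightarrow> P (hecke_step n k x v)" and "P v"
  shows "P (row n k x v)"
proof (induction k rule: row_induct[where n = n])
  case (top k)
  then show ?case using assms(2) by (simp add: row_trivial)
next
  case (step k)
  then show ?case by (subst row_unfold) (rule assms(1))
qed

lemma nonneg_row: "(\<And>w. nonneg (v w)) \<Longrightarrow> nonneg (row n k (X j) v w)"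
  using row_preserves[of "\<lambda>v. \<forall>w. nonneg (v w)" n "X j" v k] nonneg_hecke_step by blast

lemma swap_hecke: "swap_vars i (hecke n k v w) = hecke n k (\<lambda>w. swap_vars i (v w)) w"
  by (simp add: hecke_def swap_vars_add)

lemma swap_hecke_step: "swap_vars i (hecke_step n k x v w) = hecke_step n k (swap_vars i x) (\<lambda>w. swap_vars i (v w)) w"
  by (simp add: hecke_step_def swap_hecke swap_vars_add swap_vars_mult)

lemma swap_row: "swap_vars i (row n k x v w) = row n k (swap_vars i x) (\<lambda>w. swap_vars i (v w)) w"
proof (induction k arbitrary: w rule: row_induct[where n = n])
  case (top k)
  then show ?case by (simp add: row_trivial)
next
  case (step k)
  show ?case by (subst (1 2) row_unfold) (simp add: swap_hecke_step step)
qed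

lemma adj_simps: "adj i i = Suc i" "adj i (Suc i) = i"
  "j \<noteq> i \<Longrightarrow> j \<noteq> Suc i \<Longrightarrow> adj i j = j"
  by (auto simp: Transposition.transpose_def)

definition free_of :: "nat \<Rightarrow> mpoly \<Rightarrow> bool" where
  "free_of j f \<longleftrightarrow> (\<forall>m \<in> supp f. lookup m j = 0)"

lemma swap_vars_free:
  assumes "free_of i f" "free_of (Suc i) f"
  shows "swap_vars i f = f"
proof (rule poly_mapping_eqI)
  fix m
  have fixed: "swap_exp i k = k" if "k \<in> supp f" for k
    using assms that
    by (intro poly_mapping_eqI) (auto simp: lookup_swap_exp free_of_def Transposition.transpose_def)
  show "lookup (swap_vars i f) m = lookup f m"
  proof (cases "m \<in> supp f \<or> swap_exp i m \<in> supp f")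
    case True
    then have "swap_exp i m = m" using fixed by (metis swap_exp_swap_exp)
    then show ?thesis by (simp add: lookup_swap_vars)
  next
    case False
    then show ?thesis by (simp add: lookup_swap_vars in_keys_iff)
  qed
qed

lemma double_row_symmetric:
  assumes "\<And>w. swap_vars i (v w) = v w"
  shows "swap_vars i (row n k (X (Suc i)) (row n k (X i) v) w) = row n k (X (Suc i)) (row n k (X i) v) w"
  by (simp add: swap_row swap_vars_X adj_simps assms) (metis row_commute)

section \<open>Diagonals without gaps\<close>

text \<open>
  On the diagonal of all monomials that differ only in how a fixed sum is distributed between the exponents of
  $x_i$ and $x_{i+1}$, one may move one step towards the middle.  For a symmetric support this
  means that each diagonal meets it in an interval around the middle.
\<close>

definition diag_convex :: "nat \<Rightarrow> (nat \<Rightarrow>\<^sub>0 nat) set \<Rightarrow> bool" where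
  "diag_convex i S \<longleftrightarrow>
     (\<forall>m. m + unit_exp i \<in> S \<and> lookup m (Suc i) \<le> lookup m i \<longrightarrow> m + unit_exp (Suc i) \<in> S)"

definition centred :: "nat \<Rightarrow> mpoly \<Rightarrow> bool" where
  "centred i f \<longleftrightarrow> nonneg f \<and> swap_vars i f = f \<and> diag_convex i (supp f)"

lemma centred_0 [simp]: "centred i 0"
  by (simp add: centred_def diag_convex_def)

lemma centred_add: "centred i f \<Longrightarrow> centred i g \<Longrightarrow> centred i (f + g)"
  by (auto simp: centred_def diag_convex_def supp_add nonneg_add swap_vars_add)

lemma centred_X_mult:
  assumes "centred i f" "j \<noteq> i" "j \<noteq> Suc i"
  shows "centred i (X j * f)"
proof -
  have "diag_convex i (shift j (supp f))"
    unfolding diag_convex_def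
  proof (intro allI impI, elim conjE)
    fix m assume m: "m + unit_exp i \<in> shift j (supp f)" "lookup m (Suc i) \<le> lookup m i"
    then obtain k where k: "k \<in> supp f" "m + unit_exp i = k + unit_exp j" by (auto simp: shift_def)
    from k(2) obtain r where r: "m = r + unit_exp j" "k = r + unit_exp i"
      by (rule exp_add_eq) (use assms in auto)
    then have "r + unit_exp (Suc i) \<in> supp f"
      using assms m(2) k(1) by (auto simp: centred_def diag_convex_def lookup_add)
    then show "m + unit_exp (Suc i) \<in> shift j (supp f)"
      unfolding shift_def r by (metis (no_types, lifting) add.assoc add.commute image_eqI)
  qed
  with assms show ?thesis
    by (simp add: centred_def nonneg_X_mult swap_vars_mult swap_vars_X adj_simps supp_X_mult)
qed

lemma centred_XX_mult:
  assumes "centred i f"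
  shows "centred i (X i * (X (Suc i) * f))"
proof -
  have "diag_convex i (shift i (shift (Suc i) (supp f)))"
    unfolding diag_convex_def
  proof (intro allI impI, elim conjE)
    fix m assume m: "m + unit_exp i \<in> shift i (shift (Suc i) (supp f))" "lookup m (Suc i) \<le> lookup m i"
    then obtain k where k: "k \<in> supp f" "m = k + unit_exp (Suc i)" by (auto simp: shift_def)
    with m(2) have "lookup k (Suc i) < lookup k i" by (simp add: lookup_add)
    then obtain r where r: "k = r + unit_exp i" by (metis exp_split less_nat_zero_code)
    then have "r + unit_exp (Suc i) \<in> supp f"
      using assms m(2) k by (auto simp: centred_def diag_convex_def lookup_add)
    moreover have "m + unit_exp (Suc i) = r + unit_exp (Suc i) + unit_exp (Suc i) + unit_exp i"
      by (simp add: k r ac_simps)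
    ultimately show "m + unit_exp (Suc i) \<in> shift i (shift (Suc i) (supp f))"
      by (auto simp: shift_def)
  qed
  with assms show ?thesis
    by (simp add: centred_def nonneg_X_mult swap_vars_mult swap_vars_X adj_simps supp_X_mult
        mult.left_commute)
qed

lemma centred_hecke: "(\<And>w. centred i (v w)) \<Longrightarrow> centred i (hecke n k v w)"
  by (simp add: hecke_def centred_add)

text \<open>
  By induction along \<open>double_row\<close>.  Everything except $g=yC+x(1+y)f$ inherits the property from \<open>C\<close>.
  That $g$ is symmetric follows from $g=(x+y+xy)\,C-xy\,CT_{k+1}$.  In a diagonal of $g$, a monomial from $yC$
  moves inwards within $yC$; one from $xf$ moves into $yf$, hence into $yC$; and one from $xyf$ moves into
  $y\cdot yf$, which is part of $yC$ at a descent, while at an ascent $f=C$ and the move is possible within $xyC$.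
\<close>

lemma centred_double_row:
  assumes nn: "\<And>w. nonneg (v w)" and free: "\<And>w. free_of i (v w)" "\<And>w. free_of (Suc i) (v w)"
  shows "centred i (row n k (X (Suc i)) (row n k (X i) v) w)"
proof (induction k arbitrary: w rule: row_induct[where n = n])
  case (top k)
  have "m + unit_exp i \<notin> supp (v w)" for m
    using free(1)[of w] by (auto simp: free_of_def lookup_add)
  then show ?case using top nn swap_vars_free[OF free]
    by (simp add: row_trivial centred_def diag_convex_def)
next
  case (step k)
  let ?x = "X i" and ?y = "X (Suc i)"
  define C where "C = row n (Suc k) ?y (row n (Suc k) ?x v)"
  define f where "f = row n (Suc (Suc k)) ?y (row n (Suc k) ?x v)"
  define g where "g = (\<lambda>w. ?y * C w + ?x * (1 + ?y) * f w)"
  have C: "centred i (C w)" for w using step(2) by (simp add: C_def)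
  have Cf: "C = hecke_step n (Suc k) ?y f" unfolding C_def f_def by (subst row_unfold) simp
  have nf: "nonneg (f w)" for w unfolding f_def by (intro nonneg_row nn)
  have nC: "nonneg (C w)" for w using C by (simp add: centred_def)
  have g_sym: "g w = (?x + ?y + ?x * ?y) * C w - ?x * ?y * hecke n (Suc k) C w" for w
    unfolding Cf g_def by (simp add: hecke_step_eq hecke_linear hecke_idem algebra_simps)
  have g_eq: "g w = ?y * C w + (?x * f w + ?y * (?x * f w))" for w
    by (simp add: g_def algebra_simps)
  have ng: "nonneg (g w)" for w
    unfolding g_eq by (intro nonneg_add nonneg_X_mult nC nf)
  have sg: "supp (g w) = shift (Suc i) (supp (C w)) \<union>
      (shift i (supp (f w)) \<union> shift (Suc i) (shift i (supp (f w))))" for w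
    unfolding g_eq by (simp add: supp_add nonneg_X_mult nonneg_add nC nf supp_X_mult)
  have sC: "supp (C w) = supp (f w) \<union> shift (Suc i) (supp (hecke n (Suc k) f w))" for w
    unfolding Cf by (simp add: hecke_step_def supp_add nonneg_X_mult nonneg_hecke nf supp_X_mult)
  have "centred i (g w)" for w
    unfolding centred_def diag_convex_def
  proof (intro conjI allI impI ng)
    show "swap_vars i (g w) = g w"
    proof -
      have "swap_vars i (C w) = C w" for w using C by (simp add: centred_def)
      then show ?thesis unfolding g_sym
        by (simp add: swap_vars_diff swap_vars_add swap_vars_mult swap_hecke swap_vars_X adj_simps
            algebra_simps)
    qed
    fix m assume "m + unit_exp i \<in> supp (g w) \<and> lookup m (Suc i) \<le> lookup m i"
    then have m: "m + unit_exp i \<in> supp (g w)" "lookup m (Suc i) \<le> lookup m i" by auto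
    from m(1) consider
      (C) p where "p \<in> supp (C w)" "m + unit_exp i = p + unit_exp (Suc i)"
      | (x) "m \<in> supp (f w)"
      | (xy) p where "p \<in> supp (f w)" "m + unit_exp i = p + unit_exp i + unit_exp (Suc i)"
      unfolding sg by (auto simp: shift_def)
    then show "m + unit_exp (Suc i) \<in> supp (g w)"
    proof cases
      case C
      from C(2) obtain r where r: "m = r + unit_exp (Suc i)" "p = r + unit_exp i" 
        by (rule exp_add_eq) auto
      then have "r + unit_exp (Suc i) \<in> supp (C w)"
        using \<open>centred i (C w)\<close> C(1) m(2) by (auto simp: centred_def diag_convex_def lookup_add)
      then show ?thesis by (auto simp: sg shift_def r)
    next
      case x
      then show ?thesis by (auto simp: sg sC shift_def)
    next
      case xy
      have mp: "m = p + unit_exp (Suc i)"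
      proof -
        have "m + unit_exp i = p + unit_exp (Suc i) + unit_exp i" using xy(2) by (simp add: ac_simps)
        then show ?thesis by simp
      qed
      show ?thesis
      proof (cases "Suc k < n \<and> w (Suc (Suc k)) < w (Suc k)")
        case True
        then have "p \<in> supp (hecke n (Suc k) f w)"
          using xy(1) by (simp add: hecke_def supp_add nf)
        then show ?thesis by (auto simp: sg sC shift_def mp)
      next
        case False
        then have fC: "f w = C w" unfolding Cf hecke_step_def hecke_def by auto
        from m(2) mp have "lookup p (Suc i) < lookup p i" by (simp add: lookup_add)
        then obtain r where r: "p = r + unit_exp i" by (metis exp_split less_nat_zero_code)
        then have "r + unit_exp (Suc i) \<in> supp (C w)"
          using C[of w] xy(1) \<open>lookup p (Suc i) < lookup p i\<close>
          by (auto simp: centred_def diag_convex_def lookup_add fC)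
        moreover have "m + unit_exp (Suc i) = r + unit_exp (Suc i) + unit_exp i + unit_exp (Suc i)"
          by (simp add: mp r ac_simps)
        ultimately show ?thesis by (auto simp: sg fC shift_def)
      qed
    qed
  qed
  then have "centred i (hecke n k g w)" by (rule centred_hecke)
  moreover have "hecke n k g = (\<lambda>w. ?y * hecke n k C w + ?x * (1 + ?y) * hecke n k f w)"
    unfolding g_def by (simp add: hecke_linear)
  moreover have "centred i (?x * (?y * hecke n (Suc k) (hecke n k C) w))"
    by (intro centred_XX_mult centred_hecke C)
  ultimately show ?case
    unfolding double_row(1)[of n k ?y ?x v, folded C_def f_def]
    using C by (simp add: centred_add mult.assoc)
qed

section \<open>Supports before and after an isobaric divided difference\<close>

text \<open>
  The monomial \<open>m\<close> occurs in $\pi_i$ of the monomial \<open>p\<close>, for \<open>p\<close> with the $i$-th exponent at least the next one: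
  $\pi_i(x_i^ax_{i+1}^b)$ consists of the monomials between $x_i^ax_{i+1}^b$ and $x_i^bx_{i+1}^a$, and
  of those between $x_i^ax_{i+1}^{b+1}$ and $x_i^{b+1}x_{i+1}^a$ in the next degree.
\<close>

definition source_of :: "nat \<Rightarrow> (nat \<Rightarrow>\<^sub>0 nat) \<Rightarrow> (nat \<Rightarrow>\<^sub>0 nat) \<Rightarrow> bool" where
  "source_of i m p \<longleftrightarrow> (\<forall>j. j \<noteq> i \<longrightarrow> j \<noteq> Suc i \<longrightarrow> lookup p j = lookup m j) \<and>
     lookup m i \<le> lookup p i \<and> lookup m (Suc i) \<le> lookup p i \<and>
     (lookup m i + lookup m (Suc i) = lookup p i + lookup p (Suc i) \<or>
      lookup m i + lookup m (Suc i) = Suc (lookup p i + lookup p (Suc i)))"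

text \<open>
  Properties of $f$ and $g=\pi_if$ that survive sums and multiplication by other
  variables, and hence all later rows.
\<close>

definition demazure_pair :: "nat \<Rightarrow> mpoly \<Rightarrow> mpoly \<Rightarrow> bool" where
  "demazure_pair i f g \<longleftrightarrow> nonneg f \<and> centred i g \<and> supp f \<subseteq> supp g \<and>
     (\<forall>m \<in> supp f. m + unit_exp (Suc i) \<in> supp g \<or> swap_exp i m \<in> supp f) \<and>
     (\<forall>m \<in> supp g. \<exists>p \<in> supp f. source_of i m p)"

lemma demazure_pair_0 [simp]: "demazure_pair i 0 0"
  by (simp add: demazure_pair_def)

lemma demazure_pair_add:
  assumes "demazure_pair i f g" "demazure_pair i f' g'"
  shows "demazure_pair i (f + f') (g + g')"
proof -
  have "nonneg f" "nonneg f'" "nonneg g" "nonneg g'"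
    using assms by (auto simp: demazure_pair_def centred_def)
  then have s: "supp (f + f') = supp f \<union> supp f'" "supp (g + g') = supp g \<union> supp g'"
    by (simp_all add: supp_add)
  have "centred i (g + g')" "nonneg (f + f')"
    using assms by (auto simp: demazure_pair_def intro: centred_add nonneg_add)
  then show ?thesis
    using assms unfolding demazure_pair_def s by blast
qed

lemma demazure_pair_X_mult:
  assumes "demazure_pair i f g" and j: "j \<noteq> i" "j \<noteq> Suc i"
  shows "demazure_pair i (X j * f) (X j * g)"
  unfolding demazure_pair_def supp_X_mult
proof (intro conjI ballI)
  show "nonneg (X j * f)" "centred i (X j * g)" "shift j (supp f) \<subseteq> shift j (supp g)"
    using assms by (auto simp: demazure_pair_def shift_def intro: nonneg_X_mult centred_X_mult)
next
  fix m assume "m \<in> shift j (supp f)"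
  then obtain k where k: "k \<in> supp f" "m = k + unit_exp j" by (auto simp: shift_def)
  then have "k + unit_exp (Suc i) \<in> supp g \<or> swap_exp i k \<in> supp f"
    using assms by (auto simp: demazure_pair_def)
  moreover have "m + unit_exp (Suc i) = k + unit_exp (Suc i) + unit_exp j" "swap_exp i m = swap_exp i k + unit_exp j"
    using j by (simp_all add: k ac_simps swap_exp_add swap_exp_unit_exp adj_simps)
  ultimately show "m + unit_exp (Suc i) \<in> shift j (supp g) \<or> swap_exp i m \<in> shift j (supp f)"
    unfolding shift_def by auto
next
  fix m assume "m \<in> shift j (supp g)"
  then obtain k where k: "k \<in> supp g" "m = k + unit_exp j" by (auto simp: shift_def)
  then obtain p where "p \<in> supp f" "source_of i k p"
    using assms by (auto simp: demazure_pair_def)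
  then have "p + unit_exp j \<in> shift j (supp f)" "source_of i m (p + unit_exp j)"
    using j by (auto simp: source_of_def shift_def k lookup_add)
  then show "\<exists>p \<in> shift j (supp f). source_of i m p" by blast
qed

lemma demazure_pair_row:
  assumes "\<And>w. demazure_pair i (f w) (g w)" and j: "j \<noteq> i" "j \<noteq> Suc i"
  shows "demazure_pair i (row n k (X j) f w) (row n k (X j) g w)"
proof (induction k arbitrary: w rule: row_induct[where n = n])
  case (top k)
  then show ?case using assms by (simp add: row_trivial)
next
  case (step k)
  have "demazure_pair i (hecke n k (row n (Suc k) (X j) f) w) (hecke n k (row n (Suc k) (X j) g) w)" for w
    by (simp add: hecke_def demazure_pair_add step(2))
  then show ?case
    by (subst (1 2) row_unfold)
       (simp add: hecke_step_def demazure_pair_add demazure_pair_X_mult[OF _ j] step(2))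
qed

text \<open>
  Here $C=f(1+yT_k)$.  At a descent \<open>w\<close> of position \<open>k\<close> the support of $C(w)$ consists of that of $f(w)$ and the
  multiples by $y$ of those of $f(w)$ and $f(ws_k)$; at an ascent $C(w)=f(w)$.  For the source of a monomial
  take the outermost monomial on its diagonal.  It cannot come from
  $y\,f(ws_k)$: since $f(ws_k)$ is symmetric, there would be a monomial still further out.
\<close>

lemma demazure_pair_double_row:
  assumes nn: "\<And>w. nonneg (v w)" and free: "\<And>w. free_of i (v w)" "\<And>w. free_of (Suc i) (v w)"
  shows "demazure_pair i (row n (Suc k) (X (Suc i)) (row n k (X i) v) w)
           (row n k (X (Suc i)) (row n k (X i) v) w)"
proof -
  define f where "f = row n (Suc k) (X (Suc i)) (row n k (X i) v)"
  define C where "C = row n k (X (Suc i)) (row n k (X i) v)"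
  have C: "centred i (C w)" for w
    unfolding C_def by (rule centred_double_row) (fact assms)+
  have Cf: "C = hecke_step n k (X (Suc i)) f"
    unfolding C_def f_def by (subst row_unfold) simp
  have nf: "nonneg (f w)" for w unfolding f_def by (intro nonneg_row nn)
  have sC: "supp (C w) = supp (f w) \<union> shift (Suc i) (supp (hecke n k f w))" for w
    unfolding Cf by (simp add: hecke_step_def supp_add nonneg_X_mult nonneg_hecke nf supp_X_mult)
  have sym: "swap_exp i m \<in> supp (C w)" if "m \<in> supp (C w)" for m w
    using C[of w] that by (metis centred_def supp_swap)
  have noasc: "f w = C w" if "\<not> (k < n \<and> w (Suc k) < w k)" for w
    using that unfolding Cf hecke_step_def hecke_def by auto
  have "demazure_pair i (f w) (C w)"
    unfolding demazure_pair_def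
  proof (intro conjI ballI nf C)
    show "supp (f w) \<subseteq> supp (C w)" by (simp add: sC)
  next
    fix m assume m: "m \<in> supp (f w)"
    show "m + unit_exp (Suc i) \<in> supp (C w) \<or> swap_exp i m \<in> supp (f w)"
    proof (cases "k < n \<and> w (Suc k) < w k")
      case True
      then have "m \<in> supp (hecke n k f w)" using m by (simp add: hecke_def supp_add nf)
      then show ?thesis by (auto simp: sC shift_def)
    next
      case False
      then show ?thesis using m sym noasc by metis
    qed
  next
    fix m assume m: "m \<in> supp (C w)"
    define D where "D = {p \<in> supp (C w). (\<forall>j. j \<noteq> i \<longrightarrow> j \<noteq> Suc i \<longrightarrow> lookup p j = lookup m j) \<and>
        lookup p i + lookup p (Suc i) = lookup m i + lookup m (Suc i)}"
    have Dm: "m \<in> D" using m by (simp add: D_def)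
    have Dswap: "swap_exp i p \<in> D" if "p \<in> D" for p
      using that sym by (auto simp: D_def lookup_swap_exp adj_simps)
    have "finite D" unfolding D_def by simp
    then have fin: "finite ((\<lambda>p. lookup p i) ` D)" by simp
    have "Max ((\<lambda>p. lookup p i) ` D) \<in> (\<lambda>p. lookup p i) ` D" using Dm by (intro Max_in fin) auto
    then obtain p where p: "p \<in> D" "lookup p i = Max ((\<lambda>p. lookup p i) ` D)" by auto
    have mx: "lookup q i \<le> lookup p i" if "q \<in> D" for q
      unfolding p(2) using that fin by (intro Max_ge) auto
    have le: "lookup m i \<le> lookup p i" "lookup m (Suc i) \<le> lookup p i"
      using mx[OF Dm] mx[OF Dswap[OF Dm]] by (simp_all add: lookup_swap_exp adj_simps)
    from p(1) have "p \<in> supp (C w)" by (simp add: D_def)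
    then consider "p \<in> supp (f w)"
      | (w) q where "q \<in> supp (f w)" "p = q + unit_exp (Suc i)"
      | (ws) q where "q \<in> supp (f (w \<circ> adj k))" "p = q + unit_exp (Suc i)" "k < n" "w (Suc k) < w k"
      unfolding sC hecke_def by (auto simp: shift_def supp_add nf split: if_splits)
    then show "\<exists>p \<in> supp (f w). source_of i m p"
    proof cases
      case 1
      then show ?thesis using p(1) le by (intro bexI[of _ p]) (auto simp: D_def source_of_def)
    next
      case w
      then show ?thesis using p(1) le
        by (intro bexI[of _ q]) (auto simp: D_def source_of_def lookup_add)
    next
      case ws
      have "f (w \<circ> adj k) = C (w \<circ> adj k)" using ws(4) by (intro noasc) (auto simp: adj_simps)
      then have "swap_exp i q \<in> supp (f (w \<circ> adj k))" using sym ws(1) by metis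
      then have "swap_exp i q \<in> supp (hecke n k f w)"
        using ws(3,4) by (simp add: hecke_def supp_add nf)
      then have "swap_exp i q + unit_exp (Suc i) \<in> supp (C w)" by (auto simp: sC shift_def)
      then have "swap_exp i (swap_exp i q + unit_exp (Suc i)) \<in> supp (C w)" by (rule sym)
      then have "q + unit_exp i \<in> supp (C w)" by (simp add: swap_exp_add swap_exp_unit_exp adj_simps)
      then have "q + unit_exp i \<in> D" using p(1) ws(2) by (auto simp: D_def lookup_add)
      from mx[OF this] ws(2) have False by (simp add: lookup_add)
      then show ?thesis ..
    qed
  qed
  then show ?thesis by (simp add: f_def C_def)
qed

section \<open>Rows of pipe dreams\<close>

definition ident_vec :: vec where
  "ident_vec w = (if w = id then 1 else 0)"

primrec rows :: "nat \<Rightarrow> nat \<Rightarrow> vec" where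
  "rows n 0 = ident_vec"
| "rows n (Suc i) = row n (Suc i) (X (Suc i)) (rows n i)"

text \<open>
  The partial products $A_1(x_1)\cdots A_i(x_i)\,A_{i+1}(x_{i+1})\,A_{i+1}(x_{i+2})A_{i+2}(x_{i+3})\cdots$: after
  row \<open>i + 1\<close> all rows start one position late.  These are the rows that the other entries see when the
  entry 1 ends at position \<open>i + 1\<close>.
\<close>

primrec delayed_rows :: "nat \<Rightarrow> nat \<Rightarrow> nat \<Rightarrow> vec" where
  "delayed_rows n i 0 = rows n i"
| "delayed_rows n i (Suc d) = row n (max (Suc i) (i + d)) (X (Suc (i + d))) (delayed_rows n i d)"

lemma nonneg_rows: "nonneg (rows n i w)"
proof (induction i arbitrary: w)
  case 0
  then show ?case by (simp add: ident_vec_def nonneg_def lookup_one when_def)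
next
  case (Suc i)
  then show ?case by (simp add: nonneg_row)
qed

lemma free_of_0 [simp]: "free_of j 0"
  by (simp add: free_of_def)

lemma free_of_add: "free_of j f \<Longrightarrow> free_of j g \<Longrightarrow> free_of j (f + g)"
  unfolding free_of_def using keys_add[of f g] by blast

lemma free_of_hecke_step: 
  assumes "\<And>w. free_of j (v w)" "i \<noteq> j"
  shows "free_of j (hecke_step n k (X i) v w)"
proof -
  have "free_of j (hecke n k v w)" using assms by (simp add: hecke_def free_of_add)
  then have "free_of j (X i * hecke n k v w)"
    using assms(2) by (auto simp: free_of_def supp_X_mult shift_def lookup_add)
  then show ?thesis using assms by (simp add: hecke_step_def free_of_add)
qed

lemma free_of_row: "(\<And>w. free_of j (v w)) \<Longrightarrow> i \<noteq> j \<Longrightarrow> free_of j (row n k (X i) v w)"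
  using row_preserves[of "\<lambda>v. \<forall>w. free_of j (v w)" n "X i" v k] free_of_hecke_step by blast

lemma free_of_rows: "j = 0 \<or> i < j \<Longrightarrow> free_of j (rows n i w)"
proof (induction i arbitrary: w)
  case 0
  then show ?case by (simp add: ident_vec_def free_of_def)
next
  case (Suc i)
  then show ?case by (auto intro!: free_of_row)
qed

text \<open>
  The two products differ only in row \<open>a + 2\<close>, which starts at position \<open>a + 2\<close> in one and at \<open>a + 1\<close> in the
  other; the later rows involve neither $x_{a+1}$ nor $x_{a+2}$.
\<close>

lemma demazure_pair_delayed:
  "demazure_pair (Suc a) (delayed_rows n (Suc a) (Suc d) w) (delayed_rows n a (Suc (Suc d)) w)"
proof (induction d arbitrary: w)
  case 0
  have "demazure_pair (Suc a)
     (row n (Suc (Suc a)) (X (Suc (Suc a))) (row n (Suc a) (X (Suc a)) (rows n a)) w)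
     (row n (Suc a) (X (Suc (Suc a))) (row n (Suc a) (X (Suc a)) (rows n a)) w)"
    by (rule demazure_pair_double_row) (simp_all add: nonneg_rows free_of_rows)
  then show ?case by (simp add: max_def)
next
  case (Suc d)
  have "demazure_pair (Suc a)
    (row n (Suc (Suc (a + d))) (X (Suc (Suc (Suc (a + d))))) (delayed_rows n (Suc a) (Suc d)) w)
    (row n (Suc (Suc (a + d))) (X (Suc (Suc (Suc (a + d))))) (delayed_rows n a (Suc (Suc d))) w)"
    by (rule demazure_pair_row[OF Suc]) auto
  moreover have "max (Suc (Suc a)) (Suc a + Suc d) = Suc (Suc (a + d))"
    "max (Suc a) (a + Suc (Suc d)) = Suc (Suc (a + d))" by auto
  moreover have "Suc (Suc a + Suc d) = Suc (Suc (Suc (a + d)))"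
    "Suc (a + Suc (Suc d)) = Suc (Suc (Suc (a + d)))" by auto
  ultimately show ?case by (metis delayed_rows.simps(2))
qed

section \<open>Deleting the entry 1\<close>

definition delete_one :: "nat \<Rightarrow> (nat \<Rightarrow> nat) \<Rightarrow> nat \<Rightarrow> nat" where
  "delete_one p w j = w (if j < p then j else Suc j) - 1"

text \<open>
  On the permutations with the entry 1 at position \<open>p\<close>, the vector \<open>v\<close> is \<open>c\<close> times the vector \<open>u\<close> of
  one size less.
\<close>

definition restricts :: "nat \<Rightarrow> nat \<Rightarrow> mpoly \<Rightarrow> vec \<Rightarrow> vec \<Rightarrow> bool" where
  "restricts n p c v u \<longleftrightarrow>
     (\<forall>w. w permutes {1..Suc n} \<longrightarrow> w p = 1 \<longrightarrow> v w = c * u (delete_one p w))"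

lemma gt_1_off_one:
  fixes w :: "nat \<Rightarrow> nat"
  assumes "w permutes {1..n}" "w p = 1" "j \<in> {1..n}" "j \<noteq> p"
  shows "1 < w j"
proof -
  have "w j \<in> {1..n}" using permutes_in_image[OF assms(1)] assms(3) by blast
  moreover have "w j \<noteq> w p" using permutes_inj[OF assms(1)] assms(4) by (simp add: inj_eq)
  ultimately show ?thesis using assms(2) unfolding atLeastAtMost_iff by linarith
qed

lemma delete_one_adj:
  assumes "p \<le> i"
  shows "delete_one p (w \<circ> adj (Suc i)) = delete_one p w \<circ> adj i"
  using assms by (auto simp: fun_eq_iff delete_one_def Transposition.transpose_def)

lemma restricts_hecke_step:
  assumes r: "restricts n p c v u" and p: "1 \<le> p" "p \<le> i"
  shows "restricts n p c (hecke_step (Suc n) (Suc i) x v) (hecke_step n i x u)"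
  unfolding restricts_def
proof (intro allI impI)
  fix w assume w: "w permutes {1..Suc n}" "w p = 1"
  have "hecke (Suc n) (Suc i) v w = c * hecke n i u (delete_one p w)"
  proof (cases "i < n")
    case True
    have big: "1 < w (Suc i)" "1 < w (Suc (Suc i))"
      using gt_1_off_one[OF w] True p by auto
    have "(w \<circ> adj (Suc i)) p = 1" using w(2) p by (simp add: adj_simps)
    moreover have "w \<circ> adj (Suc i) permutes {1..Suc n}" using True w by (intro adj_permutes) auto
    ultimately have "v (w \<circ> adj (Suc i)) = c * u (delete_one p w \<circ> adj i)"
      using r p by (simp add: restricts_def delete_one_adj)
    moreover have "v w = c * u (delete_one p w)" using r w by (simp add: restricts_def)
    moreover have "delete_one p w (Suc i) < delete_one p w i \<longleftrightarrow> w (Suc (Suc i)) < w (Suc i)"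
      using p big by (auto simp: delete_one_def)
    ultimately show ?thesis using True by (simp add: hecke_def distrib_left)
  qed (simp add: hecke_def)
  moreover have "v w = c * u (delete_one p w)" using r w by (simp add: restricts_def)
  ultimately show "hecke_step (Suc n) (Suc i) x v w = c * hecke_step n i x u (delete_one p w)"
    by (simp add: hecke_step_def algebra_simps)
qed

lemma restricts_row:
  assumes r: "restricts n p c v u" and p: "1 \<le> p" "p \<le> k"
  shows "restricts n p c (row (Suc n) (Suc k) x v) (row n k x u)"
  using p
proof (induction k rule: row_induct[where n = n])
  case (top k)
  then show ?case using r by (simp add: row_trivial)
next
  case (step k)
  then show ?case
    by (subst (1 2) row_unfold) (simp add: restricts_hecke_step)
qed

definition vanishes :: "nat \<Rightarrow> nat \<Rightarrow> vec \<Rightarrow> bool" where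
  "vanishes n q v \<longleftrightarrow> (\<forall>w p. w permutes {1..n} \<longrightarrow> w p = 1 \<longrightarrow> q \<le> p \<longrightarrow> v w = 0)"

lemma vanishes_hecke_step:
  assumes "vanishes n q v" "1 \<le> i" "i \<noteq> q - 1"
  shows "vanishes n q (hecke_step n i x v)"
  unfolding vanishes_def
proof (intro allI impI)
  fix w p assume w: "w permutes {1..n}" "w p = 1" "q \<le> p"
  have "hecke n i v w = 0"
  proof (cases "i < n")
    case True
    have "q \<le> adj i p" using w(3) assms by (auto simp: Transposition.transpose_def)
    moreover have "(w \<circ> adj i) (adj i p) = 1" using w by simp
    moreover have "w \<circ> adj i permutes {1..n}" using True w assms by (intro adj_permutes) auto
    ultimately have "v (w \<circ> adj i) = 0" using assms(1) unfolding vanishes_def by blast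
    moreover have "v w = 0" using assms w by (auto simp: vanishes_def)
    ultimately show ?thesis by (simp add: hecke_def)
  qed (simp add: hecke_def)
  then show "hecke_step n i x v w = 0" using assms w by (auto simp: vanishes_def hecke_step_def)
qed

lemma vanishes_row:
  assumes "vanishes n q v" "1 \<le> k" "q \<le> k"
  shows "vanishes n q (row n k x v)"
  using assms
proof (induction k rule: row_induct[where n = n])
  case (top k)
  then show ?case by (simp add: row_trivial)
next
  case (step k)
  then show ?case by (subst row_unfold) (auto intro!: vanishes_hecke_step)
qed

text \<open>
  The entry 1 starts at position 1, and row \<open>k + 1\<close> can move it only if it stands at position \<open>k + 1\<close>, with its last
  factor $1+x_{k+1}T_{k+1}$: rows move it to the right one step at a time, each step costing the variable of the row, until one
  row leaves it in place for good.  To the right of the entry 1 the position \<open>j + 1\<close> of the larger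
  permutation is position \<open>j\<close> of the smaller one.
\<close>

lemma rows_restrict_delayed:
  "vanishes (Suc n) (k + 2) (rows (Suc n) k) \<and>
   (\<forall>i \<le> k. restricts n (Suc i) (\<Prod>j = 1..i. X j) (rows (Suc n) k) (delayed_rows n i (k - i)))"
proof (induction k)
  case 0
  have "delete_one 1 w = id \<longleftrightarrow> w = id" if w: "w permutes {1..Suc n}" "w 1 = 1" for w
  proof
    assume d: "delete_one 1 w = id"
    show "w = id"
    proof
      fix j
      show "w j = id j"
      proof (cases "j \<in> {1..Suc n}")
        case True
        then obtain k where k: "j = Suc k" by (cases j) auto
        show ?thesis
        proof (cases "j = 1")
          case False
          then have "1 < w j" "k \<noteq> 0" using gt_1_off_one[OF w True] k by auto
          then show ?thesis using fun_cong[OF d, of k] k by (auto simp: delete_one_def)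
        qed (use w in simp)
      next
        case False
        then show ?thesis using permutes_not_in[OF w(1)] by simp
      qed
    qed
  next
    assume "w = id" then show "delete_one 1 w = id" by (auto simp: fun_eq_iff delete_one_def)
  qed
  then show ?case
    by (auto simp: vanishes_def restricts_def ident_vec_def)
next
  case (Suc k)
  let ?x = "X (Suc k)"
  define v where "v = row (Suc n) (Suc (Suc k)) ?x (rows (Suc n) k)"
  have next_row: "rows (Suc n) (Suc k) = hecke_step (Suc n) (Suc k) ?x v"
    by (simp add: v_def) (subst row_unfold, simp)
  have van: "vanishes (Suc n) (k + 2) v"
    using Suc unfolding v_def by (intro vanishes_row) auto
  then have "vanishes (Suc n) (Suc k + 2) v" by (auto simp: vanishes_def)
  then have "vanishes (Suc n) (Suc k + 2) (rows (Suc n) (Suc k))"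
    unfolding next_row by (intro vanishes_hecke_step) auto
  moreover have res: "restricts n (Suc i) (\<Prod>j = 1..i. X j) v (row n (Suc k) ?x (delayed_rows n i (k - i)))"
    if "i \<le> k" for i
    using Suc that unfolding v_def by (intro restricts_row) auto
  have "restricts n (Suc i) (\<Prod>j = 1..i. X j) (rows (Suc n) (Suc k)) (delayed_rows n i (Suc k - i))"
    if i: "i \<le> Suc k" for i
  proof -
    consider "i < k" | "i = k" | "i = Suc k" using i by linarith
    then show ?thesis
    proof cases
      case 1
      have "restricts n (Suc i) (\<Prod>j = 1..i. X j) (rows (Suc n) (Suc k))
              (row n k ?x (delayed_rows n i (k - i)))"
        unfolding next_row using 1
        by (subst row_unfold) (intro restricts_hecke_step res, auto)
      moreover have "Suc k - i = Suc (k - i)" "max (Suc i) (i + (k - i)) = k" "i + (k - i) = k"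
        using 1 by auto
      ultimately show ?thesis by (metis delayed_rows.simps(2))
    next
      case 2
      have "restricts n (Suc k) (\<Prod>j = 1..k. X j) (rows (Suc n) (Suc k))
              (row n (Suc k) ?x (delayed_rows n k 0))"
        unfolding restricts_def
      proof (intro allI impI)
        fix w assume w: "w permutes {1..Suc n}" "w (Suc k) = 1"
        \<comment> \<open>the entry 1 is the bottom of an ascent\<close>
        have "hecke (Suc n) (Suc k) v w = 0"
          using gt_1_off_one[OF w, of "Suc (Suc k)"] w(2) by (auto simp: hecke_def)
        then have "rows (Suc n) (Suc k) w = v w" unfolding next_row by (simp add: hecke_step_def)
        also have "\<dots> = (\<Prod>j = 1..k. X j) * row n (Suc k) ?x (delayed_rows n k 0) (delete_one (Suc k) w)"
          using res[of k] w by (simp add: restricts_def)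
        finally show "rows (Suc n) (Suc k) w = \<dots>" .
      qed
      then show ?thesis by (simp add: 2 max_def)
    next
      case 3
      have "restricts n (Suc (Suc k)) (\<Prod>j = 1..Suc k. X j) (rows (Suc n) (Suc k)) (rows n (Suc k))"
        unfolding restricts_def
      proof (intro allI impI)
        fix w assume w: "w permutes {1..Suc n}" "w (Suc (Suc k)) = 1"
        have kn: "Suc k < Suc n"
        proof (rule ccontr)
          assume "\<not> Suc k < Suc n"
          then have "w (Suc (Suc k)) = Suc (Suc k)" using permutes_not_in[OF w(1)] by auto
          then show False using w by simp
        qed
        have gt: "1 < w (Suc k)" using gt_1_off_one[OF w, of "Suc k"] kn by auto
        have w': "w \<circ> adj (Suc k) permutes {1..Suc n}" "(w \<circ> adj (Suc k)) (Suc k) = 1"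
          using adj_permutes[OF w(1) _ kn] w(2) by (simp_all add: adj_simps)
        have "delete_one (Suc k) (w \<circ> adj (Suc k)) = delete_one (Suc (Suc k)) w"
          by (auto simp: fun_eq_iff delete_one_def Transposition.transpose_def not_less_less_Suc_eq)
        then have "v (w \<circ> adj (Suc k)) = (\<Prod>j = 1..k. X j) * rows n (Suc k) (delete_one (Suc (Suc k)) w)"
          using res[of k] w' by (simp add: restricts_def)
        moreover have "v w = 0" using van w by (auto simp: vanishes_def)
        ultimately show "rows (Suc n) (Suc k) w
            = (\<Prod>j = 1..Suc k. X j) * rows n (Suc k) (delete_one (Suc (Suc k)) w)"
          unfolding next_row using kn gt w(2) by (simp add: hecke_step_def hecke_def ac_simps)
      qed
      then show ?thesis by (simp add: 3)
    qed
  qed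
  ultimately show ?case by blast
qed

text \<open>
  The rows of index at least \<open>n\<close> are trivial, so this is the full product.
\<close>

definition pos_groth :: "nat \<Rightarrow> vec" where "pos_groth n = rows n n"

lemma pos_groth_delete_one:
  assumes "w permutes {1..Suc n}" "w (Suc i) = 1" "i \<le> n"
  shows "pos_groth (Suc n) w = (\<Prod>j = 1..i. X j) * delayed_rows n i (Suc n - i) (delete_one (Suc i) w)"
  using assms rows_restrict_delayed[of n "Suc n"] by (simp add: pos_groth_def restricts_def)

section \<open>Raising exponents\<close>

lemma centred_between:
  assumes g: "centred i g" and p: "p \<in> supp g"
    and agree: "\<And>j. j \<noteq> i \<Longrightarrow> j \<noteq> Suc i \<Longrightarrow> lookup q j = lookup p j"
    and sum: "lookup q i + lookup q (Suc i) = lookup p i + lookup p (Suc i)"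
    and le: "lookup q i \<le> lookup p i" "lookup q (Suc i) \<le> lookup p i"
  shows "q \<in> supp g"
  using p agree sum le
proof (induction "lookup p i" arbitrary: p rule: less_induct)
  case less
  consider "lookup q i = lookup p i" | "lookup q (Suc i) = lookup p i"
    | "lookup q i < lookup p i" "lookup q (Suc i) < lookup p i" using less.prems by linarith
  then show ?case
  proof cases
    case 1
    have "q = p"
    proof (rule poly_mapping_eqI)
      fix j show "lookup q j = lookup p j"
        using 1 less.prems by (cases "j = i \<or> j = Suc i") auto
    qed
    then show ?thesis using less by simp
  next
    case 2
    have "q = swap_exp i p"
    proof (rule poly_mapping_eqI)
      fix j show "lookup q j = lookup (swap_exp i p) j"
        using 2 less.prems by (cases "j = i \<or> j = Suc i") (auto simp: lookup_swap_exp adj_simps)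
    qed
    then show ?thesis using less g by (metis centred_def supp_swap swap_exp_swap_exp)
  next
    case 3
    then obtain r where r: "p = r + unit_exp i" by (metis exp_split less_nat_zero_code)
    have "lookup r (Suc i) \<le> lookup r i" using 3 less.prems(3) by (simp add: r lookup_add)
    then have "r + unit_exp (Suc i) \<in> supp g"
      using g less.prems(1) r by (auto simp: centred_def diag_convex_def)
    then show ?thesis
      by (rule less.hyps[rotated]) (use 3 less.prems in \<open>auto simp: r lookup_add\<close>)
  qed
qed

definition saturated :: "(nat \<Rightarrow> nat) \<Rightarrow> mpoly \<Rightarrow> bool" where
  "saturated \<beta> f \<longleftrightarrow> (\<forall>m \<in> supp f. \<forall>j \<ge> 1.
     lookup m j \<le> \<beta> j \<and> (lookup m j < \<beta> j \<longrightarrow> m + unit_exp j \<in> supp f))"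

text \<open>
  Let \<open>p\<close> be a source of \<open>m\<close>.  If both have the same degree, raising the exponent in \<open>p\<close> and moving along the
  diagonal raises it in \<open>m\<close>; the exponent of $x_i$ in \<open>p\<close> may already be maximal, but then the next
  exponent is raised instead, which is as good since \<open>m\<close> is strictly less unbalanced.  If \<open>m\<close> has one degree more,
  raise the exponent of $x_{i+1}$ in \<open>p\<close> first.  The hypotheses on $\beta$ say that this is possible whenever
  the exponent of $x_i$ in \<open>m\<close> is not maximal.
\<close>

lemma saturated_demazure_pair:
  assumes pair: "demazure_pair i f g" and sat: "saturated \<beta> f" and i: "1 \<le> i"
    and b: "\<beta> (Suc i) \<le> \<beta> i" "\<beta> i \<le> Suc (\<beta> (Suc i))"
  shows "saturated (\<beta>(Suc i := \<beta> i)) g"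
proof -
  note centred = pair[unfolded demazure_pair_def, THEN conjunct2, THEN conjunct1]
  have sub: "p \<in> supp g" if "p \<in> supp f" for p
    using pair that by (auto simp: demazure_pair_def)
  have up: "p + unit_exp (Suc i) \<in> supp g \<or> swap_exp i p \<in> supp f" if "p \<in> supp f" for p
    using pair that by (auto simp: demazure_pair_def)
  have sym: "swap_exp i m \<in> supp g" if "m \<in> supp g" for m
    using centred that by (metis centred_def supp_swap)
  have bound: "lookup p j \<le> \<beta> j" if "p \<in> supp f" "1 \<le> j" for p j
    using sat that by (auto simp: saturated_def)
  have raise: "p + unit_exp j \<in> supp f" if "p \<in> supp f" "1 \<le> j" "lookup p j < \<beta> j" for p j
    using sat that by (auto simp: saturated_def)
  have source: "\<exists>p \<in> supp f. source_of i m p" if "m \<in> supp g" for m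
    using pair that by (auto simp: demazure_pair_def)
  have raise_i: "m + unit_exp i \<in> supp g" if m: "m \<in> supp g" "lookup m i < \<beta> i" for m
  proof -
    have level: "m + unit_exp i \<in> supp g" if p: "p \<in> supp f" "source_of i m p"
      "lookup m i + lookup m (Suc i) = lookup p i + lookup p (Suc i)" for p
    proof (cases "lookup p i < \<beta> i")
      case True
      then have "p + unit_exp i \<in> supp g" using raise p i sub by blast
      then show ?thesis
        by (rule centred_between[OF centred]) (use p in \<open>auto simp: source_of_def lookup_add\<close>)
    next
      case False
      have "p + unit_exp (Suc i) \<in> supp g"
      proof (cases "p + unit_exp (Suc i) \<in> supp g")
        case False
        then have s: "swap_exp i p \<in> supp f" using up p by blast
        have "lookup p (Suc i) \<le> lookup m i" using p by (auto simp: source_of_def)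
        then have "lookup (swap_exp i p) i < \<beta> i"
          using m by (simp add: lookup_swap_exp adj_simps)
        then have "swap_exp i p + unit_exp i \<in> supp g" using raise s i sub by blast
        then show ?thesis using sym by (fastforce simp: swap_exp_add swap_exp_unit_exp adj_simps)
      qed
      then show ?thesis
        by (rule centred_between[OF centred])
           (use p m False in \<open>auto simp: source_of_def lookup_add\<close>)
    qed
    from source[OF m(1)] obtain p where p: "p \<in> supp f" "source_of i m p" by blast
    then consider "lookup m i + lookup m (Suc i) = lookup p i + lookup p (Suc i)"
      | "lookup m i + lookup m (Suc i) = Suc (lookup p i + lookup p (Suc i))" by (auto simp: source_of_def)
    then show ?thesis
    proof cases
      case 1
      then show ?thesis using level p by blast
    next
      case 2
      have "lookup p (Suc i) < lookup m i" using p(2) 2 by (auto simp: source_of_def)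
      then have "lookup p (Suc i) < \<beta> (Suc i)" using m(2) b by simp
      then have "p + unit_exp (Suc i) \<in> supp f" using raise p by simp
      then show ?thesis
        by (rule level) (use p 2 in \<open>auto simp: source_of_def lookup_add\<close>)
    qed
  qed
  have raise_other: "m + unit_exp j \<in> supp g"
    if m: "m \<in> supp g" "lookup m j < \<beta> j" and j: "1 \<le> j" "j \<noteq> i" "j \<noteq> Suc i" for m j
  proof -
    from source[OF m(1)] obtain p where p: "p \<in> supp f" "source_of i m p" by blast
    then have "lookup p j < \<beta> j" using m j by (simp add: source_of_def)
    then have pj: "p + unit_exp j \<in> supp f" using raise p j by blast
    from p consider "lookup m i + lookup m (Suc i) = lookup p i + lookup p (Suc i)"
      | "lookup m i + lookup m (Suc i) = Suc (lookup p i + lookup p (Suc i))" by (auto simp: source_of_def)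
    then show ?thesis
    proof cases
      case 1
      show ?thesis
        by (rule centred_between[OF centred sub[OF pj]])
           (use p j 1 in \<open>auto simp: source_of_def lookup_add\<close>)
    next
      case 2
      have "p + unit_exp j + unit_exp (Suc i) \<in> supp g"
      proof (cases "lookup p (Suc i) < \<beta> (Suc i)")
        case True
        then have "p + unit_exp j + unit_exp (Suc i) \<in> supp f" using raise pj j by (simp add: lookup_add)
        then show ?thesis by (rule sub)
      next
        case False
        have "lookup p (Suc i) < lookup p i" using p(2) 2 by (auto simp: source_of_def)
        then have "\<beta> (Suc i) < lookup p i" using False by simp
        \<comment> \<open>the exchanged monomial would exceed the bound for $x_{i+1}$\<close>
        then have "swap_exp i (p + unit_exp j) \<notin> supp f"
          using bound[of "swap_exp i (p + unit_exp j)" "Suc i"] j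
          by (auto simp: lookup_swap_exp adj_simps lookup_add)
        then show ?thesis using up pj by blast
      qed
      then show ?thesis
        by (rule centred_between[OF centred]) (use p j 2 in \<open>auto simp: source_of_def lookup_add\<close>)
    qed
  qed
  show ?thesis
    unfolding saturated_def
  proof (intro ballI allI impI conjI)
    fix m j assume m: "m \<in> supp g" and j: "(1::nat) \<le> j"
    from source[OF m] obtain p where p: "p \<in> supp f" "source_of i m p" by blast
    show "lookup m j \<le> (\<beta>(Suc i := \<beta> i)) j"
      using p bound[OF p(1) i] bound[OF p(1) j] unfolding source_of_def
      by (cases "j = i \<or> j = Suc i") auto
    assume lt: "lookup m j < (\<beta>(Suc i := \<beta> i)) j"
    consider "j = i" | "j = Suc i" | "j \<noteq> i" "j \<noteq> Suc i" by blast
    then show "m + unit_exp j \<in> supp g"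
    proof cases
      case 2
      then have "swap_exp i m + unit_exp i \<in> supp g"
        using sym[OF m] lt by (intro raise_i) (auto simp: lookup_swap_exp adj_simps)
      from sym[OF this] show ?thesis by (simp add: 2 swap_exp_add swap_exp_unit_exp adj_simps)
    qed (use m lt j raise_i raise_other in auto)
  qed
qed

lemma saturated_X_mult:
  assumes "saturated \<beta> f"
  shows "saturated (\<beta>(i := Suc (\<beta> i))) (X i * f)"
  unfolding saturated_def supp_X_mult
proof (intro ballI allI impI conjI)
  fix m j assume m: "m \<in> shift i (supp f)" and j: "(1::nat) \<le> j"
  then obtain k where k: "k \<in> supp f" "m = k + unit_exp i" by (auto simp: shift_def)
  show "lookup m j \<le> (\<beta>(i := Suc (\<beta> i))) j"
    using assms k j by (auto simp: saturated_def lookup_add)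
  assume "lookup m j < (\<beta>(i := Suc (\<beta> i))) j"
  then have "k + unit_exp j \<in> supp f"
    using assms k j by (auto simp: saturated_def lookup_add split: if_splits)
  moreover have "m + unit_exp j = k + unit_exp j + unit_exp i" by (simp add: k ac_simps)
  ultimately show "m + unit_exp j \<in> shift i (supp f)" by (auto simp: shift_def)
qed

lemma saturated_prod_X_mult:
  assumes "saturated \<beta> f"
  shows "saturated (\<lambda>j. if 1 \<le> j \<and> j \<le> i then Suc (\<beta> j) else \<beta> j) ((\<Prod>j = 1..i. X j) * f)"
proof (induction i)
  case 0
  have "(\<lambda>j. if 1 \<le> j \<and> j \<le> 0 then Suc (\<beta> j) else \<beta> j) = \<beta>" by auto
  then show ?case using assms by simp
next
  case (Suc i)
  have "(\<lambda>j. if 1 \<le> j \<and> j \<le> Suc i then Suc (\<beta> j) else \<beta> j) =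
    (\<lambda>j. if 1 \<le> j \<and> j \<le> i then Suc (\<beta> j) else \<beta> j)(Suc i := Suc (\<beta> (Suc i)))"
    by auto
  then show ?case using saturated_X_mult[OF Suc, of "Suc i"] by (simp add: ac_simps)
qed

section \<open>Descents of a fireworks permutation\<close>

definition descents_from :: "nat \<Rightarrow> (nat \<Rightarrow> nat) \<Rightarrow> nat \<Rightarrow> nat set" where
  "descents_from n w j = {p. 1 \<le> p \<and> j \<le> p \<and> p < n \<and> w (Suc p) < w p}"

text \<open>
  The pattern form of the fireworks condition; unlike the form with runs it visibly passes to the permutation
  with the entry 1 deleted.
\<close>

definition ascent_tops_are_records :: "nat \<Rightarrow> (nat \<Rightarrow> nat) \<Rightarrow> bool" where
  "ascent_tops_are_records n w \<longleftrightarrow>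
     (\<forall>i j. 1 \<le> i \<and> i < j \<and> j < n \<and> w j < w (Suc j) \<longrightarrow> w i < w (Suc j))"

lemma finite_descents_from [simp]: "finite (descents_from n w j)"
  by (simp add: descents_from_def)

lemma card_descents_from_Suc:
  "card (descents_from n w (Suc j)) \<le> card (descents_from n w j)"
  "card (descents_from n w j) \<le> Suc (card (descents_from n w (Suc j)))"
proof -
  show "card (descents_from n w (Suc j)) \<le> card (descents_from n w j)"
    by (rule card_mono) (auto simp: descents_from_def)
  have "descents_from n w j \<subseteq> insert j (descents_from n w (Suc j))"
    by (auto simp: descents_from_def)
  then have "card (descents_from n w j) \<le> card (insert j (descents_from n w (Suc j)))"
    by (intro card_mono) auto
  also have "\<dots> \<le> Suc (card (descents_from n w (Suc j)))" by (simp add: card_insert_if)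
  finally show "card (descents_from n w j) \<le> Suc (card (descents_from n w (Suc j)))" .
qed

lemma delete_one_permutes:
  assumes w: "w permutes {1..Suc n}" "w p = 1" and p: "p \<in> {1..Suc n}"
  shows "delete_one p w permutes {1..n}"
proof (rule inj_imp_permutes)
  have gt: "1 < w j" if "j \<in> {1..Suc n}" "j \<noteq> p" for j
    using gt_1_off_one[OF w that] .
  define up where "up j = (if j < p then j else Suc j)" for j
  have up: "up j \<in> {1..Suc n}" "up j \<noteq> p" if "j \<in> {1..n}" for j
    using that p by (auto simp: up_def)
  have d: "delete_one p w j = w (up j) - 1" for j by (simp add: delete_one_def up_def)
  show "inj_on (delete_one p w) {1..n}"
  proof (rule inj_onI)
    fix i j assume ij: "i \<in> {1..n}" "j \<in> {1..n}" "delete_one p w i = delete_one p w j"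
    then have "w (up i) = w (up j)"
      using gt[OF up[OF ij(1)]] gt[OF up[OF ij(2)]] by (simp add: d)
    then have "up i = up j" using permutes_inj[OF w(1)] by (simp add: inj_eq)
    then show "i = j" by (auto simp: up_def split: if_splits)
  qed
  show "delete_one p w j \<in> {1..n}" if "j \<in> {1..n}" for j
  proof -
    have "w (up j) \<in> {1..Suc n}" using permutes_in_image[OF w(1)] up[OF that] by blast
    then show ?thesis using gt[OF up[OF that]] by (auto simp: d)
  qed
  show "delete_one p w j = j" if "j \<notin> {1..n}" for j
  proof -
    have "j = 0 \<or> Suc n \<le> j" using that by auto
    then show ?thesis
      using p permutes_not_in[OF w(1), of 0] permutes_not_in[OF w(1), of "Suc j"]
      by (auto simp: delete_one_def)
  qed
qed simp

text \<open>
  The positions right of \<open>p\<close> are shifted by one.  Position \<open>p\<close> carries an ascent of \<open>w\<close>, and position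
  \<open>p - 1\<close> a descent of \<open>w\<close> that becomes an ascent of \<open>u\<close>: the entry after the 1 is the top of an ascent,
  hence larger than all entries before it.
\<close>

lemma delete_one_descents:
  assumes w: "w permutes {1..Suc n}" "w p = 1" and p: "p \<in> {1..Suc n}"
    and rec: "ascent_tops_are_records (Suc n) w"
  defines "u \<equiv> delete_one p w"
  shows "ascent_tops_are_records n u"
    and "card (descents_from (Suc n) w p) = card (descents_from n u p)"
    and "1 \<le> j \<Longrightarrow> j < p \<Longrightarrow> card (descents_from (Suc n) w j) = Suc (card (descents_from n u j))"
    and "p < j \<Longrightarrow> card (descents_from (Suc n) w j) = card (descents_from n u (j - 1))"
proof -
  have gt: "1 < w j" if "1 \<le> j" "j \<le> Suc n" "j \<noteq> p" for j
    using gt_1_off_one[OF w, of j] that by auto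
  have u: "u j = (if j < p then w j - 1 else w (Suc j) - 1)" for j
    by (simp add: u_def delete_one_def)
  have recD: "w i < w (Suc j)" if "1 \<le> i" "i < j" "j < Suc n" "w j < w (Suc j)" for i j
    using rec that by (auto simp: ascent_tops_are_records_def)
  have jump: "w (p - 1) < w (Suc p)" if "1 < p" "p < Suc n"
    using recD[of "p - 1" p] gt[of "Suc p"] that w by auto
  show "ascent_tops_are_records n u"
    unfolding ascent_tops_are_records_def
  proof (intro allI impI, elim conjE)
    fix i j assume ij: "1 \<le> i" "i < j" "j < n" "u j < u (Suc j)"
    consider "Suc j < p" | "Suc j = p" | "p \<le> j" by linarith
    then show "u i < u (Suc j)"
    proof cases
      case 1
      then have "w j < w (Suc j)" using ij by (simp add: u)
      then have "w i < w (Suc j)" using recD[of i j] ij by simp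
      then show ?thesis using 1 ij gt[of i] by (simp add: u)
    next
      case 2
      then have "1 < w (Suc p)" using ij gt[of "Suc p"] by auto
      then have "w i < w (Suc p)" using 2 ij recD[of i p] w by auto
      then show ?thesis using 2 ij gt[of i] by (auto simp: u)
    next
      case 3
      then have "w (Suc j) < w (Suc (Suc j))" using ij(4) by (auto simp: u)
      then have "w i < w (Suc (Suc j))" "w (Suc i) < w (Suc (Suc j))"
        using recD[of _ "Suc j"] ij by auto
      then show ?thesis using 3 ij gt[of i] gt[of "Suc i"] by (auto simp: u)
    qed
  qed
  have hi: "descents_from (Suc n) w (Suc j) = Suc ` descents_from n u j" if "p \<le> j" for j
  proof
    show "Suc ` descents_from n u j \<subseteq> descents_from (Suc n) w (Suc j)"
      using that p by (auto simp: descents_from_def u)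
    show "descents_from (Suc n) w (Suc j) \<subseteq> Suc ` descents_from n u j"
    proof
      fix q assume q: "q \<in> descents_from (Suc n) w (Suc j)"
      then obtain r where r: "q = Suc r" by (cases q) (auto simp: descents_from_def)
      have "r \<in> descents_from n u j"
        using q that p gt[of "Suc r"] gt[of "Suc (Suc r)"] by (auto simp: descents_from_def u r)
      then show "q \<in> Suc ` descents_from n u j" using r by blast
    qed
  qed
  have at: "descents_from (Suc n) w p = Suc ` descents_from n u p"
  proof -
    have "p \<notin> descents_from (Suc n) w p" using w gt[of "Suc p"] by (auto simp: descents_from_def)
    then have "descents_from (Suc n) w p = descents_from (Suc n) w (Suc p)"
      by (auto simp: descents_from_def le_less Suc_le_eq)
    then show ?thesis using hi by simp
  qed
  show "card (descents_from (Suc n) w p) = card (descents_from n u p)"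
    using at by (simp add: card_image)
  show "card (descents_from (Suc n) w j) = card (descents_from n u (j - 1))" if "p < j"
    using hi[of "j - 1"] that by (simp add: card_image)
  show "card (descents_from (Suc n) w j) = Suc (card (descents_from n u j))" if j: "1 \<le> j" "j < p"
  proof -
    define L where "L = {q. j \<le> q \<and> Suc q < p \<and> w (Suc q) < w q}"
    have finL: "finite L" by (rule finite_subset[of _ "{..p}"]) (auto simp: L_def)
    have "w p < w (p - 1)" using gt[of "p - 1"] w j p by auto
    then have "p - 1 \<in> descents_from (Suc n) w j" using j p by (auto simp: descents_from_def)
    then have "descents_from (Suc n) w j = insert (p - 1) (L \<union> descents_from (Suc n) w p)"
      using j p by (auto simp: descents_from_def L_def)
    then have W: "descents_from (Suc n) w j = insert (p - 1) (L \<union> Suc ` descents_from n u p)"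
      by (simp add: at)
    have "\<not> u p < u (p - 1)" if "p \<le> n" 
      using jump that j gt[of "p - 1"] by (auto simp: u)
    then have "p - 1 \<notin> descents_from n u j" using j by (auto simp: descents_from_def)
    then have U: "descents_from n u j = L \<union> descents_from n u p"
    proof -
      have "q \<in> L \<union> descents_from n u p" if q: "q \<in> descents_from n u j" for q
      proof -
        have "q \<noteq> p - 1" using \<open>p - 1 \<notin> descents_from n u j\<close> q by auto
        then consider "Suc q < p" | "p \<le> q" by linarith
        then show ?thesis using q by cases (auto simp: L_def descents_from_def u)
      qed
      moreover have "q \<in> descents_from n u j" if "q \<in> L" for q
        using that j p gt[of q] gt[of "Suc q"] by (auto simp: L_def descents_from_def u)
      moreover have "descents_from n u p \<subseteq> descents_from n u j"
        using j by (auto simp: descents_from_def)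
      ultimately show ?thesis by blast
    qed
    have d1: "L \<inter> descents_from n u p = {}" by (auto simp: L_def descents_from_def)
    have d2: "L \<inter> Suc ` descents_from n u p = {}" by (auto simp: L_def descents_from_def)
    have d3: "p - 1 \<notin> L \<union> Suc ` descents_from n u p" by (auto simp: L_def descents_from_def)
    show ?thesis
      using d3 by (simp add: W U card_Un_disjoint[OF finL _ d1] card_Un_disjoint[OF finL _ d2] finL card_image)
  qed
qed

lemma saturated_cong:
  assumes "saturated \<beta> f" "\<And>j. 1 \<le> j \<Longrightarrow> \<beta> j = \<gamma> j"
  shows "saturated \<gamma> f"
  using assms by (simp add: saturated_def)

text \<open>
  Downward induction on \<open>i\<close>, starting at $G_u$ itself; each step applies one $\pi_i$ and
  duplicates one more entry of the vector of bounds.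
\<close>

lemma saturated_delayed_rows:
  assumes sat: "saturated (\<lambda>j. card (descents_from n u j)) (pos_groth n u)" and i: "i \<le> n"
  shows "saturated (\<lambda>j. card (descents_from n u (if j \<le> Suc i then j else j - 1)))
           (delayed_rows n i (Suc n - i) u)"
  using i
proof (induction rule: inc_induct)
  case base
  have "delayed_rows n n (Suc n - n) u = pos_groth n u"
    by (simp add: pos_groth_def row_trivial)
  moreover have "descents_from n u j = {}" if "n \<le> j" for j
    using that by (auto simp: descents_from_def)
  ultimately show ?case
    using saturated_cong[OF sat, of "\<lambda>j. card (descents_from n u (if j \<le> Suc n then j else j - 1))"]
    by simp
next
  case (step a)
  define d where "d = n - Suc a"
  have d: "Suc n - Suc a = Suc d" "Suc n - a = Suc (Suc d)" using step by (auto simp: d_def)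
  show ?case
    unfolding d
    by (rule saturated_cong[OF saturated_demazure_pair[OF demazure_pair_delayed step(3)[unfolded d]]])
       (auto simp: card_descents_from_Suc intro!: arg_cong[where f = "\<lambda>j. card (descents_from n u j)"])
qed

lemma saturated_pos_groth:
  assumes "w permutes {1..n}" "ascent_tops_are_records n w"
  shows "saturated (\<lambda>j. card (descents_from n w j)) (pos_groth n w)"
  using assms
proof (induction n arbitrary: w)
  case 0
  then show ?case by (auto simp: pos_groth_def ident_vec_def saturated_def descents_from_def)
next
  case (Suc n)
  have "1 \<in> w ` {1..Suc n}" using permutes_image[OF Suc.prems(1)] by auto
  then obtain i where i: "w (Suc i) = 1" "i \<le> n"
    by (metis (no_types, lifting) Suc_le_mono Suc_pred atLeastAtMost_iff image_iff less_eq_Suc_le One_nat_def)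
  define u where "u = delete_one (Suc i) w"
  have p: "Suc i \<in> {1..Suc n}" using i by simp
  note facts = delete_one_descents[OF Suc.prems(1) i(1) p Suc.prems(2), folded u_def]
  have "u permutes {1..n}" unfolding u_def by (rule delete_one_permutes[OF Suc.prems(1) i(1) p])
  then have "saturated (\<lambda>j. card (descents_from n u j)) (pos_groth n u)" using Suc.IH facts(1) by blast
  from saturated_prod_X_mult[OF saturated_delayed_rows[OF this i(2)], of i]
  have "saturated (\<lambda>j. if 1 \<le> j \<and> j \<le> i
        then Suc (card (descents_from n u (if j \<le> Suc i then j else j - 1)))
        else card (descents_from n u (if j \<le> Suc i then j else j - 1))) (pos_groth (Suc n) w)"
    by (simp add: pos_groth_delete_one[OF Suc.prems(1) i] u_def)
  then show ?case
  proof (rule saturated_cong)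
    fix j :: nat assume j: "1 \<le> j"
    consider "j \<le> i" | "j = Suc i" | "Suc i < j" by linarith
    then show "(if 1 \<le> j \<and> j \<le> i
        then Suc (card (descents_from n u (if j \<le> Suc i then j else j - 1)))
        else card (descents_from n u (if j \<le> Suc i then j else j - 1)))
       = card (descents_from (Suc n) w j)"
      by cases (use j facts(2) facts(3,4)[of j] in auto)
  qed
qed

section \<open>Comparison with the divided differences\<close>

text \<open>
  The rows of index \<open>a + 1\<close> and \<open>a + 2\<close> together with the additional factor $1+x_{a+2}T_{a+1}$ make up
  $A_{a+1}(x_{a+1})A_{a+1}(x_{a+2})$, and the factor commutes with the rows after them.
\<close>

lemma rows_hecke_step_symmetric:
  assumes "Suc a < k"
  shows "swap_vars (Suc a) (hecke_step n (Suc a) (X (Suc (Suc a))) (rows n k) w)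
         = hecke_step n (Suc a) (X (Suc (Suc a))) (rows n k) w"
proof -
  have "Suc (Suc a) \<le> k" using assms by simp
  then show ?thesis
  proof (induction k arbitrary: w rule: dec_induct)
    case base
    have "swap_vars (Suc a) (rows n a w) = rows n a w" for w
      by (intro swap_vars_free free_of_rows) auto
    from double_row_symmetric[OF this] show ?case
      by (simp add: row_unfold[symmetric])
  next
    case (step k)
    let ?v = "hecke_step n (Suc a) (X (Suc (Suc a))) (rows n k)"
    have "hecke_step n (Suc a) (X (Suc (Suc a))) (rows n (Suc k)) = row n (Suc k) (X (Suc k)) ?v"
      using step by (simp add: row_hecke_step_commute)
    moreover have "swap_vars (Suc a) (row n (Suc k) (X (Suc k)) ?v w) = row n (Suc k) (X (Suc k)) ?v w"
      using step by (simp add: swap_row step(3) swap_vars_X adj_simps)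
    ultimately show ?case by simp
  qed
qed

text \<open>
  Compare the symmetric vector of \<open>rows_hecke_step_symmetric\<close> at \<open>w\<close>, where it is $G_w$, and at $ws_i$, where it is
  $G_{ws_i}+x_{i+1}(G_{ws_i}+G_w)$.
\<close>

lemma pos_groth_divided_difference:
  assumes i: "1 \<le> i" "i < n" and asc: "w i < w (Suc i)"
  shows "(X i - X (Suc i)) * pos_groth n w =
    (1 + X (Suc i)) * pos_groth n (w \<circ> adj i) - (1 + X i) * swap_vars i (pos_groth n (w \<circ> adj i))"
proof -
  obtain a where a: "i = Suc a" using i by (cases i) auto
  have sym: "swap_vars i (hecke_step n i (X (Suc i)) (pos_groth n) w) = hecke_step n i (X (Suc i)) (pos_groth n) w" for w
    using rows_hecke_step_symmetric[of a n n] i by (simp add: a pos_groth_def)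
  have "hecke_step n i (X (Suc i)) (pos_groth n) w = pos_groth n w" using asc by (simp add: hecke_step_def hecke_def)
  then have "swap_vars i (pos_groth n w) = pos_groth n w" using sym[of w] by simp
  moreover have "hecke_step n i (X (Suc i)) (pos_groth n) (w \<circ> adj i) =
    pos_groth n (w \<circ> adj i) + X (Suc i) * (pos_groth n (w \<circ> adj i) + pos_groth n w)"
    using asc i by (simp add: hecke_step_def hecke_def adj_simps)
  ultimately have "swap_vars i (pos_groth n (w \<circ> adj i)) +
      X i * (swap_vars i (pos_groth n (w \<circ> adj i)) + pos_groth n w) =
    pos_groth n (w \<circ> adj i) + X (Suc i) * (pos_groth n (w \<circ> adj i) + pos_groth n w)"
    using sym[of "w \<circ> adj i"] by (simp add: swap_vars_add swap_vars_mult swap_vars_X adj_simps)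
  then show ?thesis by (simp add: algebra_simps)
qed

text \<open>
  The entry 1 of the longest permutation is the last one, so deleting it removes one full step of the staircase.
\<close>

lemma pos_groth_longest: "pos_groth n (longest_perm n) = (\<Prod>i = 1..n. X i ^ (n - i))"
proof (induction n)
  case 0
  have "longest_perm 0 = id" by (auto simp: longest_perm_def fun_eq_iff)
  then show ?case by (simp add: pos_groth_def ident_vec_def id_def)
next
  case (Suc n)
  have "delete_one (Suc n) (longest_perm (Suc n)) = longest_perm n"
    by (auto simp: fun_eq_iff delete_one_def longest_perm_def)
  moreover have "longest_perm (Suc n) (Suc n) = 1" by (simp add: longest_perm_def)
  moreover have "delayed_rows n n 1 = pos_groth n" by (simp add: pos_groth_def row_trivial)
  ultimately have "pos_groth (Suc n) (longest_perm (Suc n)) = (\<Prod>j = 1..n. X j) * (\<Prod>i = 1..n. X i ^ (n - i))"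
    using pos_groth_delete_one[OF longest_perm_permutes, of n n] Suc by simp
  also have "\<dots> = (\<Prod>j = 1..n. X j ^ (Suc n - j))"
    unfolding prod.distrib[symmetric] by (intro prod.cong) (auto simp: Suc_diff_le)
  finally show ?case by simp
qed

lemma weak_order_induct [consumes 1, case_names longest step]:
  assumes "w permutes {1..n}" and "P (longest_perm n)"
    and "\<And>w i. w permutes {1..n} \<Longrightarrow> 1 \<le> i \<Longrightarrow> i < n \<Longrightarrow> w i < w (Suc i) \<Longrightarrow> P (w \<circ> adj i) \<Longrightarrow> P w"
  shows "P w"
  using assms(1)
proof (induction "perm_length n (longest_perm n) - perm_length n w" arbitrary: w rule: less_induct)
  case less
  show ?case
  proof (cases "\<exists>i. 1 \<le> i \<and> i < n \<and> w i < w (Suc i)")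
    case True
    then obtain i where i: "1 \<le> i" "i < n" "w i < w (Suc i)" by auto
    have "perm_length n (longest_perm n) - perm_length n (w \<circ> adj i)
          < perm_length n (longest_perm n) - perm_length n w"
      using perm_length_ascent[OF i] perm_length_le[of n "w \<circ> adj i"] by linarith
    then show ?thesis using less adj_permutes i assms(3) by blast
  next
    case False
    then show ?thesis using no_ascent_imp_longest[OF less.prems] assms(2) by auto
  qed
qed

definition total_degree :: "(nat \<Rightarrow>\<^sub>0 nat) \<Rightarrow> nat" where
  "total_degree m = (\<Sum>j \<in> Poly_Mapping.keys m. lookup m j)"

lemma total_degree_superset: "finite A \<Longrightarrow> Poly_Mapping.keys m \<subseteq> A \<Longrightarrow> total_degree m = (\<Sum>j \<in> A. lookup m j)"
  unfolding total_degree_def by (rule sum.mono_neutral_left) (auto simp: in_keys_iff)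

lemma total_degree_add: "total_degree (m + k) = total_degree m + total_degree k"
proof -
  let ?A = "Poly_Mapping.keys m \<union> Poly_Mapping.keys k"
  have "total_degree (m + k) = (\<Sum>j \<in> ?A. lookup (m + k) j)"
    using keys_add[of m k] by (intro total_degree_superset) auto
  also have "\<dots> = (\<Sum>j \<in> ?A. lookup m j) + (\<Sum>j \<in> ?A. lookup k j)"
    by (simp add: lookup_add sum.distrib)
  also have "\<dots> = total_degree m + total_degree k"
    by (simp add: total_degree_superset[of ?A m] total_degree_superset[of ?A k])
  finally show ?thesis .
qed

lemma total_degree_unit_exp [simp]: "total_degree (unit_exp j) = 1"
  by (simp add: total_degree_def unit_exp_def)

lemma total_degree_0 [simp]: "total_degree 0 = 0"
  by (simp add: total_degree_def)

lemma total_degree_swap [simp]: "total_degree (swap_exp i m) = total_degree m"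
proof -
  have "total_degree (swap_exp i m) = (\<Sum>j \<in> adj i ` Poly_Mapping.keys m. lookup (swap_exp i m) j)"
  proof (rule total_degree_superset)
    show "Poly_Mapping.keys (swap_exp i m) \<subseteq> adj i ` Poly_Mapping.keys m"
    proof
      fix j assume "j \<in> Poly_Mapping.keys (swap_exp i m)"
      then have "adj i j \<in> Poly_Mapping.keys m" by (simp add: in_keys_iff lookup_swap_exp)
      then have "adj i (adj i j) \<in> adj i ` Poly_Mapping.keys m" by (rule imageI)
      then show "j \<in> adj i ` Poly_Mapping.keys m" by simp
    qed
  qed simp
  also have "\<dots> = total_degree m"
    unfolding total_degree_def by (subst sum.reindex) (auto simp: lookup_swap_exp)
  finally show ?thesis .
qed

text \<open>
  The substitution of $-x_j$ for every variable $x_j$.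
\<close>

definition sign_flip :: "mpoly \<Rightarrow> mpoly" where
  "sign_flip = Poly_Mapping.mapp (\<lambda>m c. (- 1) ^ total_degree m * c)"

lemma lookup_sign_flip: "lookup (sign_flip f) m = (- 1) ^ total_degree m * lookup f m"
  by (simp add: sign_flip_def mapp.rep_eq in_keys_iff)

lemma sign_flip_add: "sign_flip (f + g) = sign_flip f + sign_flip g"
  by (rule poly_mapping_eqI) (simp add: lookup_sign_flip lookup_add distrib_left)

lemma sign_flip_diff: "sign_flip (f - g) = sign_flip f - sign_flip g"
  by (rule poly_mapping_eqI) (simp add: lookup_sign_flip lookup_minus right_diff_distrib)

lemma sign_flip_single: "sign_flip (Poly_Mapping.single m c) = Poly_Mapping.single m ((- 1) ^ total_degree m * c)"
  by (rule poly_mapping_eqI) (auto simp: lookup_sign_flip lookup_single when_def)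

lemma sign_flip_0 [simp]: "sign_flip 0 = 0"
  by (rule poly_mapping_eqI) (simp add: lookup_sign_flip)

lemma sign_flip_mult: "sign_flip (f * g) = sign_flip f * sign_flip g"
proof (induction f rule: mpoly_induct)
  case (single m c)
  show ?case
    by (induction g rule: mpoly_induct)
       (simp_all add: mult_single sign_flip_single total_degree_add sign_flip_add distrib_left distrib_right power_add ac_simps)
qed (simp_all add: distrib_right sign_flip_add)

lemma sign_flip_1 [simp]: "sign_flip 1 = 1"
  using sign_flip_single[of 0 1] by simp

lemma sign_flip_X [simp]: "sign_flip (X i) = - X i"
  by (simp add: X_unit_exp sign_flip_single single_uminus)

lemma sign_flip_swap: "sign_flip (swap_vars i f) = swap_vars i (sign_flip f)"
  by (rule poly_mapping_eqI) (simp add: lookup_sign_flip lookup_swap_vars)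

lemma supp_sign_flip: "supp (sign_flip f) = supp f"
  by (auto simp: in_keys_iff lookup_sign_flip)

lemma K_div_diff_eqI:
  assumes "(X i - X (Suc i)) * g = (1 - X (Suc i)) * f - (1 - X i) * swap_vars i f"
  shows "K_div_diff i f = g"
proof -
  have "(X i - X (Suc i)) * K_div_diff i f = (X i - X (Suc i)) * g"
    using gen_diff_eq[of 1 i f] assms by (simp add: K_div_diff_conv_gen)
  moreover have "X i - X (Suc i) \<noteq> 0" by simp
  ultimately show ?thesis by (metis mult_left_cancel)
qed

lemma div_diff_eqI:
  assumes "(X i - X (Suc i)) * g = f - swap_vars i f"
  shows "div_diff i f = g"
  using div_diff_unique[OF div_diff_eq, of i g f] assms by simp

lemma grothendieck_sign:
  assumes "w permutes {1..n}"
  shows "grothendieck n w = sign_flip (pos_groth n w) \<or> grothendieck n w = - sign_flip (pos_groth n w)"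
  using assms
proof (induction rule: weak_order_induct)
  case longest
  have mult: "sign_flip (f * g) = f * g \<or> sign_flip (f * g) = - (f * g)"
    if "sign_flip f = f \<or> sign_flip f = - f" "sign_flip g = g \<or> sign_flip g = - g" for f g
    using that by (auto simp: sign_flip_mult)
  have pow: "sign_flip (X i ^ k) = X i ^ k \<or> sign_flip (X i ^ k) = - (X i ^ k)" for i k
    by (induction k) (auto simp: sign_flip_mult)
  have "sign_flip (\<Prod>i \<in> A. X i ^ (n - i)) = (\<Prod>i \<in> A. X i ^ (n - i)) \<or>
        sign_flip (\<Prod>i \<in> A. X i ^ (n - i)) = - (\<Prod>i \<in> A. X i ^ (n - i))" if "finite A" for A
    using that
  proof induction
    case (insert a A)
    then show ?case using mult[OF pow] by simp
  qed simp
  from this[of "{1..n}"] show ?case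
    by (auto simp: grothendieck_longest pos_groth_longest)
next
  case (step w i)
  let ?Q = "sign_flip (pos_groth n (w \<circ> adj i))"
  have eq: "- ((X i - X (Suc i)) * sign_flip (pos_groth n w)) =
      (1 - X (Suc i)) * ?Q - (1 - X i) * swap_vars i ?Q"
    using arg_cong[OF pos_groth_divided_difference[OF step(2-4)], of sign_flip]
    by (simp add: sign_flip_mult sign_flip_diff sign_flip_add sign_flip_swap algebra_simps)
  have "grothendieck n w = K_div_diff i (grothendieck n (w \<circ> adj i))"
    using step by (intro grothendieck_step perm_length_ascent)
  moreover have "K_div_diff i ?Q = - sign_flip (pos_groth n w)"
    by (rule K_div_diff_eqI) (use eq in \<open>simp add: algebra_simps\<close>)
  moreover have "K_div_diff i (- ?Q) = sign_flip (pos_groth n w)"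
  proof (rule K_div_diff_eqI)
    have "swap_vars i (- ?Q) = - swap_vars i ?Q"
      using swap_vars_diff[of i 0 ?Q] by simp
    then show "(X i - X (Suc i)) * sign_flip (pos_groth n w) =
      (1 - X (Suc i)) * - ?Q - (1 - X i) * swap_vars i (- ?Q)"
      using eq by (simp add: algebra_simps)
  qed
  ultimately show ?case using step(5) by metis
qed

lemma supp_grothendieck:
  assumes "w permutes {1..n}"
  shows "supp (grothendieck n w) = supp (pos_groth n w)"
  using grothendieck_sign[OF assms] supp_sign_flip by (auto simp: in_keys_iff lookup_sign_flip)

section \<open>The part of lowest degree\<close>

lemma perm_length_swap_ascent:
  assumes i: "1 \<le> i" "i < n" and asc: "w i < w (Suc i)"
  shows "perm_length n (w \<circ> adj i) = Suc (perm_length n w)"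
proof -
  let ?h = "\<lambda>(p, q). (adj i p, adj i q)"
  have "inversions n (w \<circ> adj i) \<subseteq> insert (i, Suc i) (?h ` inversions n w)"
  proof
    fix z assume "z \<in> inversions n (w \<circ> adj i)"
    then obtain p q where pq: "z = (p, q)" "p \<in> {1..n}" "q \<in> {1..n}" "p < q"
      "w (adj i q) < w (adj i p)" by auto
    show "z \<in> insert (i, Suc i) (?h ` inversions n w)"
    proof (cases "p = i \<and> q = Suc i")
      case False
      have "adj i p \<in> {1..n}" "adj i q \<in> {1..n}" "adj i p < adj i q"
        using pq i False by (auto simp: Transposition.transpose_def)
      then have "(adj i p, adj i q) \<in> inversions n w" using pq by auto
      then have "?h (adj i p, adj i q) \<in> ?h ` inversions n w" by (rule imageI)
      then show ?thesis by (simp add: pq(1))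
    qed (use pq in simp)
  qed
  then have "perm_length n (w \<circ> adj i) \<le> card (insert (i, Suc i) (?h ` inversions n w))"
    unfolding perm_length_def by (intro card_mono finite.insertI finite_imageI finite_inversions)
  also have "\<dots> \<le> Suc (card (?h ` inversions n w))"
    unfolding card_insert_if[OF finite_imageI[OF finite_inversions]] by simp
  also have "\<dots> \<le> Suc (perm_length n w)"
    unfolding perm_length_def using card_image_le[OF finite_inversions] by simp
  finally show ?thesis using perm_length_ascent[of i n w] assms by linarith
qed

definition generated_in_low_degree :: "nat \<Rightarrow> vec \<Rightarrow> bool" where
  "generated_in_low_degree n v \<longleftrightarrow> (\<forall>w m. w permutes {1..n} \<longrightarrow> m \<in> supp (v w) \<longrightarrow>
     perm_length n w \<le> total_degree m \<and>
     (perm_length n w < total_degree m \<longrightarrow> (\<exists>j. \<exists>k \<in> supp (v w). m = k + unit_exp j)))"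

text \<open>
  The new monomials at \<open>w\<close> are $x_j$ times old monomials at \<open>w\<close>, for which one may remove $x_j$ again, and
  $x_j$ times old monomials at $ws_i$, of length one less, for which the old statement provides a variable to remove.
\<close>

lemma generated_in_low_degree_hecke_step:
  assumes gen: "generated_in_low_degree n v" and nn: "\<And>w. nonneg (v w)" and i: "1 \<le> i"
  shows "generated_in_low_degree n (hecke_step n i (X j) v)"
  unfolding generated_in_low_degree_def
proof (intro allI impI)
  fix w m assume w: "w permutes {1..n}" and m: "m \<in> supp (hecke_step n i (X j) v w)"
  have low: "perm_length n w' \<le> total_degree k" "perm_length n w' < total_degree k \<Longrightarrow> \<exists>l. \<exists>r \<in> supp (v w'). k = r + unit_exp l"
    if "w' permutes {1..n}" "k \<in> supp (v w')" for w' k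
    using gen that unfolding generated_in_low_degree_def by blast+
  have s: "supp (hecke_step n i (X j) v w) = supp (v w) \<union> shift j (supp (hecke n i v w))"
    by (simp add: hecke_step_def supp_add nonneg_X_mult nonneg_hecke nn supp_X_mult)
  consider "m \<in> supp (v w)"
    | (w) k where "k \<in> supp (v w)" "m = k + unit_exp j"
    | (ws) k where "k \<in> supp (v (w \<circ> adj i))" "m = k + unit_exp j" "i < n" "w (Suc i) < w i"
    using m unfolding s hecke_def by (auto simp: shift_def supp_add nn split: if_splits)
  then show "perm_length n w \<le> total_degree m \<and> (perm_length n w < total_degree m \<longrightarrow>
      (\<exists>l. \<exists>k \<in> supp (hecke_step n i (X j) v w). m = k + unit_exp l))"
  proof cases
    case 1
    then show ?thesis using low[OF w 1] by (auto simp: s)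
  next
    case w
    then show ?thesis using low(1)[OF \<open>w permutes {1..n}\<close> w(1)] by (auto simp: s total_degree_add)
  next
    case ws
    have ws_perm: "w \<circ> adj i permutes {1..n}" using w i ws by (intro adj_permutes) auto
    have len: "perm_length n w = Suc (perm_length n (w \<circ> adj i))"
      using perm_length_swap_ascent[of i n "w \<circ> adj i"] i ws by (simp add: adj_simps)
    show ?thesis
    proof (intro conjI impI)
      show "perm_length n w \<le> total_degree m" using low(1)[OF ws_perm ws(1)] by (simp add: len ws total_degree_add)
      assume "perm_length n w < total_degree m"
      then obtain l r where r: "r \<in> supp (v (w \<circ> adj i))" "k = r + unit_exp l"
        using low(2)[OF ws_perm ws(1)] by (auto simp: len ws total_degree_add)
      then have "r \<in> supp (hecke n i v w)" using ws by (simp add: hecke_def supp_add nn)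
      then have "r + unit_exp j \<in> supp (hecke_step n i (X j) v w)" by (auto simp: s shift_def)
      moreover have "m = r + unit_exp j + unit_exp l" by (simp add: ws r ac_simps)
      ultimately show "\<exists>l. \<exists>k \<in> supp (hecke_step n i (X j) v w). m = k + unit_exp l" by blast
    qed
  qed
qed

lemma generated_in_low_degree_rows: "generated_in_low_degree n (rows n k)"
proof (induction k)
  case 0
  have "perm_length n id = 0" unfolding perm_length_def
    by (intro card_eq_0_iff[THEN iffD2] disjI1) auto
  then show ?case by (auto simp: generated_in_low_degree_def ident_vec_def split: if_splits)
next
  case (Suc k)
  have "generated_in_low_degree n (row n (Suc l) (X (Suc k)) (rows n k))" for l
  proof (induction l rule: row_induct[where n = n])
    case (top l)
    then show ?case using Suc by (simp add: row_trivial)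
  next
    case (step l)
    then show ?case
      by (subst row_unfold) (intro generated_in_low_degree_hecke_step nonneg_row nonneg_rows, auto)
  qed
  then show ?case by simp
qed

lemma pos_groth_low_degree:
  assumes "w permutes {1..n}" "m \<in> supp (pos_groth n w)"
  shows "perm_length n w \<le> total_degree m"
    and "perm_length n w < total_degree m \<Longrightarrow> \<exists>j. \<exists>k \<in> supp (pos_groth n w). m = k + unit_exp j"
  using generated_in_low_degree_rows[of n n] assms
  unfolding generated_in_low_degree_def pos_groth_def by blast+

definition homogeneous_part :: "nat \<Rightarrow> mpoly \<Rightarrow> mpoly" where
  "homogeneous_part d = Poly_Mapping.mapp (\<lambda>m c. if total_degree m = d then c else 0)"

lemma lookup_homogeneous_part: "lookup (homogeneous_part d f) m = (if total_degree m = d then lookup f m else 0)"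
  by (simp add: homogeneous_part_def mapp.rep_eq in_keys_iff)

lemma homogeneous_part_add: "homogeneous_part d (f + g) = homogeneous_part d f + homogeneous_part d g"
  by (rule poly_mapping_eqI) (simp add: lookup_homogeneous_part lookup_add)

lemma homogeneous_part_diff: "homogeneous_part d (f - g) = homogeneous_part d f - homogeneous_part d g"
  by (rule poly_mapping_eqI) (simp add: lookup_homogeneous_part lookup_minus)

lemma homogeneous_part_swap: "homogeneous_part d (swap_vars i f) = swap_vars i (homogeneous_part d f)"
  by (rule poly_mapping_eqI) (simp add: lookup_homogeneous_part lookup_swap_vars)

lemma homogeneous_part_X_mult: "homogeneous_part (Suc d) (X i * f) = X i * homogeneous_part d f"
proof (rule poly_mapping_eqI)
  fix m
  show "lookup (homogeneous_part (Suc d) (X i * f)) m = lookup (X i * homogeneous_part d f) m"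
  proof (cases "lookup m i = 0")
    case True
    then show ?thesis by (simp add: lookup_homogeneous_part lookup_X_mult_not)
  next
    case False
    then obtain k where "m = k + unit_exp i" by (rule exp_split)
    then show ?thesis by (simp add: lookup_homogeneous_part lookup_X_mult total_degree_add)
  qed
qed

text \<open>
  In $(x_i-x_{i+1})G_w=(1+x_{i+1})G_{ws_i}-(1+x_i)\,s_iG_{ws_i}$ the terms with an additional variable do not
  contribute in the lowest degree, so what remains there is the recursion for Schubert polynomials.
\<close>

lemma schubert_lowest_part:
  assumes "w permutes {1..n}"
  shows "schubert n w = homogeneous_part (perm_length n w) (pos_groth n w)"
  using assms
proof (induction rule: weak_order_induct)
  case longest
  let ?l = "longest_perm n"
  have mono: "\<exists>m. (\<Prod>i \<in> A. X i ^ (n - i)) = Poly_Mapping.single m 1" if "finite A" for A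
    using that
  proof induction
    case empty
    show ?case by (intro exI[of _ 0]) simp
  next
    case (insert a A)
    have "\<exists>m. X a ^ k = Poly_Mapping.single m 1" for k
    proof (induction k)
      case 0
      show ?case by (intro exI[of _ 0]) simp
    next
      case (Suc k)
      then show ?case by (auto simp: X_unit_exp mult_single)
    qed
    then obtain m k where "X a ^ (n - a) = Poly_Mapping.single m 1"
      "(\<Prod>i \<in> A. X i ^ (n - i)) = Poly_Mapping.single k 1" using insert by blast
    then show ?case using insert by (intro exI[of _ "m + k"]) (simp add: mult_single)
  qed
  obtain m where m: "pos_groth n ?l = Poly_Mapping.single m 1"
    using mono[of "{1..n}"] by (auto simp: pos_groth_longest)
  \<comment> \<open>a monomial cannot be a variable times itself\<close>
  have "total_degree m = perm_length n ?l"
  proof (rule ccontr)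
    assume "total_degree m \<noteq> perm_length n ?l"
    moreover have "m \<in> supp (pos_groth n ?l)" by (simp add: m)
    ultimately obtain j where "m = m + unit_exp j"
      using pos_groth_low_degree[OF longest_perm_permutes, of m n] by (auto simp: m)
    then have "total_degree m = total_degree (m + unit_exp j)" by (rule arg_cong)
    then show False by (simp add: total_degree_add)
  qed
  then have "homogeneous_part (perm_length n ?l) (pos_groth n ?l) = pos_groth n ?l"
    by (intro poly_mapping_eqI) (auto simp: lookup_homogeneous_part m lookup_single when_def)
  then show ?case by (simp add: pos_groth_longest schubert_longest)
next
  case (step w i)
  define d where "d = perm_length n w"
  let ?Q = "pos_groth n (w \<circ> adj i)"
  have len: "perm_length n (w \<circ> adj i) = Suc d"
    unfolding d_def by (rule perm_length_swap_ascent[OF step(2-4)])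
  have "w \<circ> adj i permutes {1..n}" using step by (intro adj_permutes)
  then have high: "Suc d \<le> total_degree m" if "m \<in> supp ?Q" for m
    using pos_groth_low_degree(1) that len by metis
  have zero: "homogeneous_part d ?Q = 0"
  proof (rule poly_mapping_eqI)
    fix m show "lookup (homogeneous_part d ?Q) m = lookup 0 m"
      using high[of m] by (cases "lookup ?Q m = 0") (auto simp: lookup_homogeneous_part in_keys_iff)
  qed
  have hX: "homogeneous_part (Suc d) ((1 + X j) * f) = homogeneous_part (Suc d) f + X j * homogeneous_part d f"
    for j f
    by (simp add: distrib_right homogeneous_part_add homogeneous_part_X_mult)
  have "(X i - X (Suc i)) * homogeneous_part d (pos_groth n w) =
      homogeneous_part (Suc d) ((X i - X (Suc i)) * pos_groth n w)"
    by (simp add: left_diff_distrib homogeneous_part_diff homogeneous_part_X_mult)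
  also have "\<dots> = homogeneous_part (Suc d) ?Q - swap_vars i (homogeneous_part (Suc d) ?Q)"
    unfolding pos_groth_divided_difference[OF step(2-4)] homogeneous_part_diff hX
    by (simp add: homogeneous_part_swap zero)
  finally have "div_diff i (homogeneous_part (Suc d) ?Q) = homogeneous_part d (pos_groth n w)"
    by (rule div_diff_eqI)
  moreover have "schubert n w = div_diff i (schubert n (w \<circ> adj i))"
    using step by (intro schubert_step perm_length_ascent)
  ultimately show ?case by (simp only: step(5) len d_def)
qed

section \<open>Runs and the closed Rothe diagram\<close>

lemma decreasing_run_exists:
  assumes "1 \<le> i" "i \<le> n"
  obtains a b where "decreasing_run n w a b" "a \<le> i" "i \<le> b"
proof -
  have "\<exists>b \<ge> i. b \<le> n \<and> (\<forall>k. i \<le> k \<and> k < b \<longrightarrow> w (k + 1) < w k) \<and> (b = n \<or> \<not> w (b + 1) < w b)"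
    using assms(2)
  proof (induction rule: inc_induct)
    case (step i)
    show ?case
    proof (cases "w (i + 1) < w i")
      case True
      from step(3) obtain b where b: "b \<ge> Suc i" "b \<le> n"
        "\<forall>k. Suc i \<le> k \<and> k < b \<longrightarrow> w (k + 1) < w k" "b = n \<or> \<not> w (b + 1) < w b" by blast
      have "w (k + 1) < w k" if "i \<le> k" "k < b" for k
        using True b(3) that by (cases "k = i") auto
      with b show ?thesis by (intro exI[of _ b]) auto
    qed (use step in auto)
  qed auto
  moreover have "\<exists>a \<le> i. 1 \<le> a \<and> (\<forall>k. a \<le> k \<and> k < i \<longrightarrow> w (k + 1) < w k) \<and> (a = 1 \<or> \<not> w a < w (a - 1))"
    using assms(1)
  proof (induction rule: dec_induct)
    case (step i)
    show ?case
    proof (cases "w (i + 1) < w i")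
      case True
      from step(3) obtain a where a: "a \<le> i" "1 \<le> a"
        "\<forall>k. a \<le> k \<and> k < i \<longrightarrow> w (k + 1) < w k" "a = 1 \<or> \<not> w a < w (a - 1)" by blast
      have "w (k + 1) < w k" if "a \<le> k" "k < Suc i" for k
        using True a(3) that by (cases "k = i") auto
      with a show ?thesis by (intro exI[of _ a]) auto
    qed (use step in \<open>auto intro!: exI[of _ "Suc i"]\<close>)
  qed auto
  ultimately obtain a b where b: "i \<le> b" "b \<le> n" "\<And>k. i \<le> k \<Longrightarrow> k < b \<Longrightarrow> w (k + 1) < w k"
      "b = n \<or> \<not> w (b + 1) < w b"
    and a: "a \<le> i" "1 \<le> a" "\<And>k. a \<le> k \<Longrightarrow> k < i \<Longrightarrow> w (k + 1) < w k"
      "a = 1 \<or> \<not> w a < w (a - 1)" by blast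
  have "w (k + 1) < w k" if "a \<le> k" "k < b" for k
    using a(3)[of k] b(3)[of k] that by (cases "k < i") auto
  then have "decreasing_run n w a b" using a b by (auto simp: decreasing_run_def)
  then show ?thesis using that a b by blast
qed

lemma fireworks_ascent_tops:
  assumes "fireworks n w"
  shows "ascent_tops_are_records n w"
  unfolding ascent_tops_are_records_def
proof (intro allI impI, elim conjE)
  fix i j assume ij: "1 \<le> i" "i < j" "j < n" "w j < w (Suc j)"
  obtain a b where ab: "decreasing_run n w a b" "a \<le> i" "i \<le> b"
    using decreasing_run_exists[of i n w] ij by auto
  obtain c d where cd: "decreasing_run n w c d" "c \<le> Suc j" "Suc j \<le> d"
    using decreasing_run_exists[of "Suc j" n w] ij by auto
  have "c = Suc j"
  proof (rule ccontr)
    assume "c \<noteq> Suc j"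
    then have "w (j + 1) < w j" using cd by (auto simp: decreasing_run_def)
    then show False using ij by simp
  qed
  then have "w a < w (Suc j)" using assms[unfolded fireworks_def, rule_format, of a b "Suc j" d] ab cd ij by simp
  moreover have "w i \<le> w a"
    using \<open>a \<le> i\<close> \<open>i \<le> b\<close>
  proof (induction rule: dec_induct)
    case (step k)
    then have "w (k + 1) < w k" using ab(1) by (auto simp: decreasing_run_def)
    then show ?case using step by simp
  qed simp
  ultimately show "w i < w (Suc j)" by simp
qed

lemma lookup_wt: "j \<in> {1..n} \<Longrightarrow> lookup (wt n D) j = card {c. (j, c) \<in> D}"
  by (simp add: wt_def lookup_sum lookup_single when_def)

text \<open>
  A column of a fireworks permutation that contains a box has as its entry $w(q)$ a value with a larger one before
  it, so $q-1$ is a descent, and then the lowest box of the column is in row $q-1$.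
\<close>

lemma wt_rothe_closure:
  assumes w: "w permutes {1..n}" and rec: "ascent_tops_are_records n w" and j: "j \<in> {1..n}"
  shows "lookup (wt n (up_closure n n (rothe n w))) j = card (descents_from n w j)"
proof -
  have "{c. (j, c) \<in> up_closure n n (rothe n w)} = (\<lambda>p. w (Suc p)) ` descents_from n w j"
  proof (intro set_eqI iffI)
    fix c assume "c \<in> {c. (j, c) \<in> up_closure n n (rothe n w)}"
    then obtain i where i: "j \<le> i" "i \<in> {1..n}" "c \<in> {1..n}" "i < inv w c" "c < w i"
      by (auto simp: up_closure_def rothe_def)
    define q where "q = inv w c"
    have wq: "w q = c" using permutes_inverses(1)[OF w] by (simp add: q_def)
    have "q \<in> {1..n}" using permutes_in_image[OF permutes_inv[OF w]] i(3) by (simp add: q_def)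
    then obtain p where p: "q = Suc p" "p < n" by (cases q) auto
    have "i \<le> p" using i p by (simp add: q_def[symmetric])
    have "w (Suc p) < w p"
    proof (rule ccontr)
      assume "\<not> w (Suc p) < w p"
      moreover have "w (Suc p) \<noteq> w p" using permutes_inj[OF w] by (simp add: inj_eq)
      ultimately have asc: "w p < w (Suc p)" by simp
      then have "i \<noteq> p" using i wq p by auto
      then have "w i < w (Suc p)"
        using rec asc \<open>i \<le> p\<close> i p unfolding ascent_tops_are_records_def by auto
      then show False using i wq p by simp
    qed
    then have "p \<in> descents_from n w j" using i p j \<open>i \<le> p\<close> by (auto simp: descents_from_def)
    then show "c \<in> (\<lambda>p. w (Suc p)) ` descents_from n w j" using wq p by blast
  next
    fix c assume "c \<in> (\<lambda>p. w (Suc p)) ` descents_from n w j"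
    then obtain p where p: "c = w (Suc p)" "1 \<le> p" "j \<le> p" "p < n" "w (Suc p) < w p"
      by (auto simp: descents_from_def)
    have "c \<in> {1..n}" unfolding p(1) permutes_in_image[OF w] using p(4) by simp
    moreover have "inv w c = Suc p" using permutes_inverses(2)[OF w] by (simp add: p(1))
    ultimately show "c \<in> {c. (j, c) \<in> up_closure n n (rothe n w)}"
      using p j unfolding up_closure_def rothe_def
      by (intro CollectI case_prodI conjI exI[of _ p]) auto
  qed
  moreover have "inj_on (\<lambda>p. w (Suc p)) (descents_from n w j)"
    using permutes_inj[OF w] by (intro inj_onI) (simp add: inj_eq)
  ultimately show ?thesis using j by (simp add: lookup_wt card_image)
qed

section \<open>The support\<close>

lemma pos_groth_exps:
  assumes "m \<in> supp (pos_groth n w)"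
  shows "m \<in> exps n"
proof -
  have "j \<in> {1..n}" if "lookup m j \<noteq> 0" for j
  proof (rule ccontr)
    assume "j \<notin> {1..n}"
    then have "free_of j (pos_groth n w)" unfolding pos_groth_def by (intro free_of_rows) auto
    then show False using assms that by (auto simp: free_of_def)
  qed
  then show ?thesis by (auto simp: exps_def in_keys_iff)
qed

lemma pos_groth_above_schubert:
  assumes w: "w permutes {1..n}" and m: "m \<in> supp (pos_groth n w)"
  shows "\<exists>\<alpha> \<in> supp (schubert n w). \<forall>j. lookup \<alpha> j \<le> lookup m j"
  using m
proof (induction "total_degree m" arbitrary: m rule: less_induct)
  case less
  show ?case
  proof (cases "perm_length n w < total_degree m")
    case True
    then obtain j k where k: "k \<in> supp (pos_groth n w)" "m = k + unit_exp j"
      using pos_groth_low_degree(2)[OF w less.prems] by blast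
    then obtain \<alpha> where "\<alpha> \<in> supp (schubert n w)" "\<forall>j. lookup \<alpha> j \<le> lookup k j"
      using less.hyps[of k] by (auto simp: total_degree_add)
    then show ?thesis using k(2) by (intro bexI[of _ \<alpha>]) (auto simp: lookup_add trans_le_add1)
  next
    case False
    then have "total_degree m = perm_length n w"
      using pos_groth_low_degree(1)[OF w less.prems] by simp
    then have "m \<in> supp (schubert n w)"
      using less.prems by (simp add: schubert_lowest_part[OF w] in_keys_iff lookup_homogeneous_part)
    then show ?thesis by blast
  qed
qed

lemma saturated_fill:
  assumes sat: "saturated \<beta> f" and "\<alpha> \<in> supp f"
    and "\<And>j. 1 \<le> j \<Longrightarrow> lookup (\<alpha> + \<delta>) j \<le> \<beta> j" and "lookup \<delta> 0 = 0"
  shows "\<alpha> + \<delta> \<in> supp f"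
  using assms(3,4)
proof (induction "total_degree \<delta>" arbitrary: \<delta> rule: less_induct)
  case less
  show ?case
  proof (cases "\<delta> = 0")
    case False
    then obtain j where j: "lookup \<delta> j \<noteq> 0" by (metis lookup_zero poly_mapping_eqI)
    then obtain k where k: "\<delta> = k + unit_exp j" by (rule exp_split)
    have j1: "1 \<le> j" using j less.prems(2) by (cases j) auto
    have "\<alpha> + k \<in> supp f"
    proof (rule less.hyps)
      show "total_degree k < total_degree \<delta>" by (simp add: k total_degree_add)
      show "lookup (\<alpha> + k) l \<le> \<beta> l" if "1 \<le> l" for l
        using less.prems(1)[OF that] by (simp add: k lookup_add)
      show "lookup k 0 = 0" using less.prems(2) by (simp add: k lookup_add)
    qed
    moreover have "lookup (\<alpha> + k) j < \<beta> j" using less.prems(1)[OF j1] by (simp add: k lookup_add)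
    ultimately have "\<alpha> + k + unit_exp j \<in> supp f" using sat j1 unfolding saturated_def by blast
    then show ?thesis by (simp add: k ac_simps)
  qed (use assms(2) in simp)
qed

theorem theorem1p1:
  fixes n :: nat and w :: "nat \<Rightarrow> nat"
  assumes "n \<ge> 1" and "w permutes {1..n}" and "fireworks n w"
  shows "(\<forall>\<alpha> \<in> exps n. \<forall>i \<in> {1..n}.
            \<alpha> \<in> supp (grothendieck n w) \<and>
            X i * xpow \<alpha> dvd xpow (wt n (up_closure n n (rothe n w))) \<longrightarrow>
            \<alpha> + Poly_Mapping.single i 1 \<in> supp (grothendieck n w))
       \<and> supp (grothendieck n w) =
           (\<Union>\<alpha> \<in> supp (schubert n w). box n \<alpha> (wt n (up_closure n n (rothe n w))))"
proof -
  let ?wt = "wt n (up_closure n n (rothe n w))"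
  have rec: "ascent_tops_are_records n w" using fireworks_ascent_tops assms(3) .
  note G = supp_grothendieck[OF assms(2)]
  have "saturated (\<lambda>j. card (descents_from n w j)) (pos_groth n w)"
    using saturated_pos_groth assms(2) rec .
  then have sat: "saturated (\<lambda>j. if j \<in> {1..n} then lookup ?wt j else 0) (pos_groth n w)"
    by (rule saturated_cong) (auto simp: wt_rothe_closure[OF assms(2) rec] descents_from_def)
  have "\<alpha> + unit_exp i \<in> supp (pos_groth n w)"
    if "i \<in> {1..n}" "\<alpha> \<in> supp (pos_groth n w)" "X i * xpow \<alpha> dvd xpow ?wt" for \<alpha> i
  proof -
    from that(3) obtain g where "xpow ?wt = X i * xpow \<alpha> * g" by (rule dvdE)
    then have "xpow ?wt = Poly_Mapping.single (unit_exp i + \<alpha>) 1 * g"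
      by (simp add: X_unit_exp xpow_def mult_single)
    then have "?wt \<in> supp (Poly_Mapping.single (unit_exp i + \<alpha>) 1 * g)"
      by (metis xpow_def keys_single singletonI zero_neq_one)
    then obtain b where "?wt = unit_exp i + \<alpha> + b"
      using keys_mult[of "Poly_Mapping.single (unit_exp i + \<alpha>) (1::int)" g] by auto
    then have "lookup \<alpha> i < lookup ?wt i" by (simp add: lookup_add)
    then show ?thesis
      using sat[unfolded saturated_def, rule_format, OF that(2), of i, THEN conjunct2] that(1) by simp
  qed
  moreover have "supp (pos_groth n w) = (\<Union>\<alpha> \<in> supp (schubert n w). box n \<alpha> ?wt)"
  proof (intro set_eqI iffI)
    fix \<gamma> assume \<gamma>: "\<gamma> \<in> supp (pos_groth n w)"
    then obtain \<alpha> where "\<alpha> \<in> supp (schubert n w)" "\<forall>j. lookup \<alpha> j \<le> lookup \<gamma> j"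
      using pos_groth_above_schubert assms(2) by blast
    moreover have "lookup \<gamma> j \<le> lookup ?wt j" if "j \<in> {1..n}" for j
      using sat[unfolded saturated_def, rule_format, OF \<gamma>, of j, THEN conjunct1] that by simp
    ultimately show "\<gamma> \<in> (\<Union>\<alpha> \<in> supp (schubert n w). box n \<alpha> ?wt)"
      using pos_groth_exps[OF \<gamma>] by (auto simp: box_def)
  next
    fix \<gamma> assume "\<gamma> \<in> (\<Union>\<alpha> \<in> supp (schubert n w). box n \<alpha> ?wt)"
    then obtain \<alpha> where \<alpha>: "\<alpha> \<in> supp (schubert n w)" and \<gamma>: "\<gamma> \<in> box n \<alpha> ?wt" by blast
    then have \<alpha>P: "\<alpha> \<in> supp (pos_groth n w)"
      by (auto simp: schubert_lowest_part[OF assms(2)] in_keys_iff lookup_homogeneous_part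
          split: if_splits)
    have out: "lookup \<gamma> j = 0" "lookup \<alpha> j = 0" if "j \<notin> {1..n}" for j
      using \<gamma> pos_groth_exps[OF \<alpha>P] that by (auto simp: box_def exps_def in_keys_iff)
    have le: "lookup \<alpha> j \<le> lookup \<gamma> j" for j
      using \<gamma> out[of j] by (cases "j \<in> {1..n}") (auto simp: box_def)
    have eq: "\<alpha> + (\<gamma> - \<alpha>) = \<gamma>"
      by (rule poly_mapping_eqI) (simp add: lookup_add lookup_minus le)
    have "\<alpha> + (\<gamma> - \<alpha>) \<in> supp (pos_groth n w)"
    proof (rule saturated_fill[OF sat \<alpha>P])
      show "lookup (\<alpha> + (\<gamma> - \<alpha>)) j \<le> (if j \<in> {1..n} then lookup ?wt j else 0)" for j
        unfolding eq using \<gamma> out[of j] by (auto simp: box_def)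
      show "lookup (\<gamma> - \<alpha>) 0 = 0" using out[of 0] by (simp add: lookup_minus)
    qed
    then show "\<gamma> \<in> supp (pos_groth n w)" by (simp add: eq)
  qed
  ultimately show ?thesis unfolding G unit_exp_def by blast
qed

end
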